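(* Consider the decentralized stochastic optimization algorithm with quantized communication described in the context, and suppose that the gradient assumption, the connectivity assumption and the quantizer assumption of the context hold (no convexity is assumed). If the positive sequences $\{\epsilon^k\}$ and $\{\lambda^k\}$ are selected such that $$\sum_{k=1}^{\infty}\epsilon^k\lambda^k=+\infty,\qquad \sum_{k=1}^{\infty}(\epsilon^k)^2<\infty,\qquad \sum_{k=1}^{\infty}\epsilon^k(\lambda^k)^2<\infty,$$ then the algorithm guarantees $$\lim_{t\to\infty}\frac{\sum_{k=0}^t\epsilon^k\lambda^k\,\mathbb{E}\left[\|\nabla f(\bar x^k)\|^2\right]}{\sum_{k=0}^t\epsilon^k\lambda^k}=0\quad\text{and}\quad \lim_{t\to\infty}\frac{\sum_{k=0}^t\epsilon^k\lambda^k\,\mathbb{E}\left[\left\|\frac1m\sum_{i=1}^m\nabla f_i(x_i^k)\right\|^2\right]}{\sum_{k=0}^t\epsilon^k\lambda^k}=0.$$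
   Context: Problem: $m$ agents seek to solve $\min_{x\in\mathbb{R}^d} f(x)$, where $f(x)=\frac1m\sum_{i=1}^m f_i(x)$ and $f_i(x)=\mathbb{E}_{\xi_i\sim\mathcal{D}_i}[F_i(x,\xi_i)]$, with $F_i$ a stochastic loss private to agent $i$ and $\mathcal{D}_i$ the local data distribution. $\|\cdot\|$ is the Euclidean norm. Algorithm: $x_i^0=0$ for all $i$, and for $k\ge 0$ each agent $i$ updates $$x_i^{k+1}=x_i^k+\epsilon^k\sum_{j\in\mathbb{N}_i}w_{ij}\left(\mathcal{Q}(x_j^k)-\mathcal{Q}(x_i^k)\right)-\epsilon^k\lambda^k g_i^k,$$ where $\epsilon^k,\lambda^k>0$ are design parameters, $\mathcal{Q}$ is a stochastic quantizer (the realization $\mathcal{Q}(x_j^k)$ is computed once by agent $j$ at iteration $k$, used by agent $j$ itself and sent to all its neighbors), and $g_i^k=g_i^k(x_i^k,\xi_i)$ is the stochastic gradient of agent $i$ at iteration $k$. The weights satisfy $w_{ij}=w_{ji}\ge 0$, with $w_{ij}>0$ exactly when agents $i$ and $j$ communicate, and $\mathbb{N}_i=\{j: w_{ij}>0\}$. Set $\bar x^k=\frac1m\sum_{i=1}^m x_i^k$. The samples and quantization randomness at iteration $k$ are drawn afresh, so the moment conditions below hold conditionally on the past. $\mathbb{E}$ of a quantity at iteration $k$ is with respect to the randomness in stochastic gradients and quantization up until iteration $k-1$. Gradient assumption: (1) every $f_i$ is Lipschitz continuous with Lipschitz gradient, $\|\nabla f_i(x)-\nabla f_i(y)\|\le L\|x-y\|$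 for all $x,y\in\mathbb{R}^d$, and the problem has at least one optimal solution $x^*$, with $\sum_{i=1}^m\nabla f_i(x^* )=0$; (2) for all $i$, $\mathbb{E}_{\xi_i\sim\mathcal{D}_i}[g_i^k]=\nabla f_i(x_i^k)$, and the stochastic gradient at any point $x$ satisfies $\mathbb{E}_{\xi_i\sim\mathcal{D}_i}[\|g_i^k-\nabla f_i(x)\|^2]\le\sigma^2$. Connectivity assumption: the interaction graph is undirected and connected, i.e. the second smallest eigenvalue $\rho$ of the graph Laplacian $L_w=D-W$ is positive, where $W=(w_{ij})$ and $D$ is diagonal with $d_{ii}=\sum_{j\in\mathbb{N}_i}w_{ij}$. Quantizer assumption: there is a constant $\beta$ such that for every $x$, $\mathbb{E}[\mathcal{Q}(x)\mid x]=x$ and $\mathbb{E}[\|\mathcal{Q}(x)-x\|^2\mid x]\le\beta\|x\|^2$; quantizations on different agents are independent of each other. *)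

theory Defs
  imports "HOL-Probability.Probability" "HOL-Computational_Algebra.Polynomial"
begin

definition gradient :: "('a::real_inner \<Rightarrow> real) \<Rightarrow> 'a \<Rightarrow> 'a" where
  "gradient f x = (THE D. GDERIV f x :> D)"

definition local_objective ::
    "('m \<Rightarrow> 's measure) \<Rightarrow> ('m \<Rightarrow> 'a \<Rightarrow> 's \<Rightarrow> real) \<Rightarrow> 'm \<Rightarrow> 'a \<Rightarrow> real" where
  "local_objective D F i x = (\<integral>s. F i x s \<partial>D i)"

definition global_objective ::
    "('m::finite \<Rightarrow> 's measure) \<Rightarrow> ('m \<Rightarrow> 'a \<Rightarrow> 's \<Rightarrow> real) \<Rightarrow> 'a \<Rightarrow> real" where
  "global_objective D F x = (\<Sum>i\<in>UNIV. local_objective D F i x) / real CARD('m)"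

definition agent_mean :: "('m::finite \<Rightarrow> 'a::real_vector) \<Rightarrow> 'a" where
  "agent_mean v = (\<Sum>i\<in>UNIV. v i) /\<^sub>R real CARD('m)"

definition neighbors :: "real^'m^'m \<Rightarrow> 'm \<Rightarrow> 'm set" where
  "neighbors W i = {j. W $ i $ j > 0}"

definition laplacian :: "real^'m^'m \<Rightarrow> real^'m^'m" where
  "laplacian W = (\<chi> i j. if i = j then \<Sum>l\<in>neighbors W i. W $ i $ l else 0) - W"

definition charpoly :: "real^'n^'n \<Rightarrow> real poly" where
  "charpoly A = det (\<chi> i j. (if i = j then [:0, 1:] else 0) - [:A $ i $ j:])"

text \<open>Eigenvalues are counted with algebraic multiplicity. The value is meaningful only for
  matrices with at least two real eigenvalues, e.g. symmetric ones of size at least two.\<close>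

definition second_smallest_eigenvalue :: "real^'n^'n \<Rightarrow> real" where
  "second_smallest_eigenvalue A = sorted_list_of_multiset (proots (charpoly A)) ! 1"

end

theory Submission
  imports Defs
begin

text \<open>
  Stack the agents into one vector \<open>X \<in> (\<real>\<^sup>d)\<^sup>m\<close>. By symmetry of the weights the
  quantization errors cancel in the mean \<open>xbar\<close>, so \<open>f(xbar)\<close> satisfies the usual descent
  inequality for stochastic gradients, up to the gradient mismatch
  \<open>d\<^sub>k = \<bbbE>|\<nabla>f(xbar) - (1/m) \<Sum> \<nabla>f\<^sub>i(x\<^sub>i)|\<^sup>2\<close>, which is bounded (the \<open>f\<^sub>i\<close> are Lipschitz) and at most
  a multiple of the disagreement \<open>u\<^sub>k\<close>, the second moment of the deviation from the mean.
  The spectral gap \<open>\<rho>\<close> contracts the disagreement, while the quantizer feeds it with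
  \<open>\<epsilon>\<^sup>2\<beta> \<bbbE>|X|\<^sup>2\<close>. With \<open>T\<^sub>k = \<Sum>\<^sub>j\<^sub><\<^sub>k \<epsilon>\<^sub>j\<lambda>\<^sub>j\<close> the crude bound \<open>\<bbbE>|xbar|\<^sup>2 = O(T\<^sub>k\<^sup>2)\<close> suffices:
  summing the recursion gives \<open>\<Sum> \<epsilon> u = O(1) + O(\<Sum> \<epsilon>\<^sup>2 T\<^sup>2) = o(T\<^sup>2)\<close>, because \<open>\<Sum> \<epsilon>\<^sup>2\<close> converges, and
  the Cauchy--Schwarz inequality \<open>(\<Sum> \<epsilon>\<lambda>d)\<^sup>2 \<le> (\<Sum> \<epsilon>\<lambda>\<^sup>2)(\<Sum> \<epsilon>d\<^sup>2)\<close> yields \<open>\<Sum> \<epsilon>\<lambda>d = o(T)\<close>.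
\<close>

subsection \<open>Gradients\<close>

text \<open>Without convexity nothing in the hypotheses keeps the iterates bounded, while the
  quantizer variance grows with the size of the state. No uniform bound on the disagreement is
  therefore aimed at; only its weighted sum has to be small against the square of \<open>T\<close>.
  That \<open>\<Sum> \<epsilon>\<^sup>2 T\<^sup>2\<close> has this property is Kronecker's lemma.
  The Cauchy-Schwarz step produces the square of \<open>d\<close>; one factor \<open>d\<close> is
  then bounded by a constant and the other by the disagreement. Both gradient averages come from a
  single descent inequality, because the inner product of the two gradients is expanded by
  polarization. Conditioning on the past is expressed by product laws and by orthogonality to
  functions of the current state, so Fubini takes the place of conditional expectations. The
  connectivity hypothesis speaks of roots of a characteristic polynomial. It is used through
  multiplicity: a nonconstant kernel vector of the Laplacian would make 0 a double root. The gap
  constant itself then comes from compactness.\<close>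

lemma GDERIV_unique:
  assumes "GDERIV f x :> D" "GDERIV f x :> E"
  shows "D = E"
proof -
  have "(\<lambda>h. h \<bullet> D) = (\<lambda>h. h \<bullet> E)"
    using assms unfolding gderiv_def by (rule has_derivative_unique)
  then show ?thesis by (simp add: fun_eq_iff vector_eq_ldot)
qed

lemma gradient_eq: "GDERIV f x :> D \<Longrightarrow> gradient f x = D"
  unfolding gradient_def using GDERIV_unique by blast

lemma GDERIV_gradient:
  fixes f :: "'a::euclidean_space \<Rightarrow> real"
  assumes "f differentiable at x"
  shows "GDERIV f x :> gradient f x"
proof -
  obtain f' where f': "(f has_derivative f') (at x)"
    using assms by (auto simp: differentiable_def)
  then have "linear f'" by (rule has_derivative_linear)
  then have "f' = (\<lambda>h. h \<bullet> adjoint f' 1)" by (simp add: adjoint_works)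
  then have "GDERIV f x :> adjoint f' 1" using f' unfolding gderiv_def by simp
  then show ?thesis by (simp add: gradient_eq)
qed

lemma GDERIV_along_line:
  assumes "GDERIV f (x + t *\<^sub>R h) :> D"
  shows "((\<lambda>t. f (x + t *\<^sub>R h)) has_real_derivative (h \<bullet> D)) (at t)"
proof -
  have "((\<lambda>t. x + t *\<^sub>R h) has_derivative (\<lambda>s. s *\<^sub>R h)) (at t)"
    by (auto intro!: derivative_eq_intros)
  from diff_chain_at[OF this assms[unfolded gderiv_def]]
  have "((\<lambda>t. f (x + t *\<^sub>R h)) has_derivative (\<lambda>s. s *\<^sub>R h \<bullet> D)) (at t)"
    by (simp add: o_def)
  then show ?thesis
    unfolding has_field_derivative_def by (simp add: mult.commute[of _ "h \<bullet> D"])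
qed

text \<open>The difference quotient in the direction \<open>D\<close> itself tends to the squared
  norm of \<open>D\<close>, while the Lipschitz bound keeps it below
  \<open>C * norm D\<close>.\<close>

lemma norm_GDERIV_le:
  assumes "C-lipschitz_on UNIV f" "GDERIV f x :> D"
  shows "norm D \<le> C"
proof -
  have "((\<lambda>t. f (x + t *\<^sub>R D)) has_real_derivative D \<bullet> D) (at 0)"
    using assms(2) by (intro GDERIV_along_line) simp
  then have "(\<lambda>t. (f (x + t *\<^sub>R D) - f x) / t) \<midarrow>0\<rightarrow> D \<bullet> D"
    by (simp add: DERIV_def)
  moreover have "(f (x + t *\<^sub>R D) - f x) / t \<le> C * norm D" for t
  proof -
    have "\<bar>f (x + t *\<^sub>R D) - f x\<bar> \<le> C * (\<bar>t\<bar> * norm D)"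
      using lipschitz_on_normD[OF assms(1), of "x + t *\<^sub>R D" x] by simp
    then have "\<bar>(f (x + t *\<^sub>R D) - f x) / t\<bar> \<le> C * norm D" if "t \<noteq> 0"
      using that by (simp add: abs_divide field_simps)
    then have "(f (x + t *\<^sub>R D) - f x) / t \<le> C * norm D" if "t \<noteq> 0"
      using that abs_le_D1 by blast
    then show ?thesis using lipschitz_on_nonneg[OF assms(1)] by (cases "t = 0") auto
  qed
  ultimately have "D \<bullet> D \<le> C * norm D"
    by (intro tendsto_upperbound[where F="at (0::real)"]) auto
  then have "norm D * norm D \<le> C * norm D" by (simp add: power2_norm_eq_inner[symmetric] power2_eq_square)
  then show ?thesis
    using lipschitz_on_nonneg[OF assms(1)] by (cases "norm D = 0") auto
qed

text \<open>The mean value theorem along the segment suffices. Bounding the intermediate point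
  \<open>t\<close> by 1 gives the constant \<open>K\<close> where integration would give
  \<open>K / 2\<close>; the factor is immaterial, since this term is summable in the
  application.\<close>

lemma descent_bound:
  assumes deriv: "\<And>x. GDERIV f x :> G x"
    and lip: "\<And>x y. norm (G x - G y) \<le> K * norm (x - y)"
  shows "f (x + h) \<le> f x + h \<bullet> G x + K * (norm h)\<^sup>2"
proof -
  \<comment> \<open>The sign of \<open>K\<close> is not assumed; the Lipschitz bound at
    \<open>x + h\<close> and \<open>x\<close> fixes the sign of the product.\<close>
  have "K * norm h \<ge> 0" using lip[of "x + h" x] by (smt (verit) add_diff_cancel_left' norm_ge_zero)
  obtain t where t: "0 < t" "t < 1" "f (x + 1 *\<^sub>R h) - f (x + 0 *\<^sub>R h) = (1 - 0) * (h \<bullet> G (x + t *\<^sub>R h))"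
    using MVT2[of 0 1 "\<lambda>t. f (x + t *\<^sub>R h)" "\<lambda>t. h \<bullet> G (x + t *\<^sub>R h)"] GDERIV_along_line[OF deriv] by auto
  then have "f (x + h) - f x = h \<bullet> G x + h \<bullet> (G (x + t *\<^sub>R h) - G x)"
    by (simp add: inner_diff_right)
  also have "h \<bullet> (G (x + t *\<^sub>R h) - G x) \<le> norm h * norm (G (x + t *\<^sub>R h) - G x)"
    by (rule norm_cauchy_schwarz)
  also have "\<dots> \<le> norm h * (K * (t * norm h))"
    using lip[of "x + t *\<^sub>R h" x] t by (intro mult_left_mono) auto
  also have "\<dots> = t * (K * norm h) * norm h" by simp
  also have "\<dots> \<le> 1 * (K * norm h) * norm h"
    using t \<open>K * norm h \<ge> 0\<close> by (intro mult_right_mono) auto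
  finally show ?thesis by (simp add: power2_eq_square)
qed

lemma GDERIV_sum:
  assumes "\<And>i. i \<in> I \<Longrightarrow> GDERIV (f i) x :> D i"
  shows "GDERIV (\<lambda>x. \<Sum>i\<in>I. f i x) x :> (\<Sum>i\<in>I. D i)"
  using assms unfolding gderiv_def inner_sum_right by (intro has_derivative_sum) auto

lemma GDERIV_global_objective:
  fixes F :: "'m::finite \<Rightarrow> 'a::euclidean_space \<Rightarrow> 's \<Rightarrow> real"
  assumes "\<And>i. local_objective D F i differentiable at y"
  shows "GDERIV (global_objective D F) y :> agent_mean (\<lambda>i. gradient (local_objective D F i) y)"
proof -
  have "GDERIV (\<lambda>y. (\<Sum>i\<in>UNIV. local_objective D F i y)) y :> (\<Sum>i\<in>UNIV. gradient (local_objective D F i) y)"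
    by (intro GDERIV_sum GDERIV_gradient assms)
  from GDERIV_mult[OF GDERIV_const[of "1 / CARD('m)"] this]
  have "GDERIV (\<lambda>y. 1 / CARD('m) * (\<Sum>i\<in>UNIV. local_objective D F i y)) y :>
      agent_mean (\<lambda>i. gradient (local_objective D F i) y)"
    by (simp add: agent_mean_def inverse_eq_divide)
  then show ?thesis by (simp add: global_objective_def[abs_def])
qed

lemma lipschitz_global_objective:
  fixes F :: "'m::finite \<Rightarrow> 'a::euclidean_space \<Rightarrow> 's \<Rightarrow> real"
  assumes "\<And>i. C-lipschitz_on UNIV (local_objective D F i)"
  shows "C-lipschitz_on UNIV (global_objective D F)"
proof (rule lipschitz_onI)
  show "C \<ge> 0" using assms by (rule lipschitz_on_nonneg)
  fix x y
  have "\<bar>(\<Sum>i\<in>UNIV. local_objective D F i x) - (\<Sum>i\<in>UNIV. local_objective D F i y)\<bar>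
      \<le> (\<Sum>i\<in>(UNIV::'m set). C * dist x y)"
    unfolding sum_subtractf[symmetric] using lipschitz_onD[OF assms, of x y]
    by (intro order.trans[OF sum_abs] sum_mono) (auto simp: dist_real_def)
  then show "dist (global_objective D F x) (global_objective D F y) \<le> C * dist x y"
    unfolding global_objective_def dist_real_def diff_divide_distrib[symmetric] abs_divide
    by (simp add: divide_le_eq mult.commute)
qed

subsection \<open>Spectral gap of the Laplacian\<close>

text \<open>Evaluation is a ring homomorphism, so it commutes with the Leibniz formula. This turns
  questions about the characteristic polynomial into real determinants, one for each
  \<open>t\<close>.\<close>

lemma poly_det: "poly (det (A :: 'a::comm_ring_1 poly^'n^'n)) t = det (\<chi> i j. poly (A $ i $ j) t)"
  unfolding det_def by (simp add: poly_sum poly_prod of_int_poly)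

lemma poly_charpoly: "poly (charpoly A) t = det (\<chi> i j. (if i = j then t else 0) - A $ i $ j)"
  unfolding charpoly_def poly_det
  by (intro arg_cong[of _ _ det]) (simp add: vec_eq_iff)

lemma laplacian_mult_nth:
  assumes "\<And>i j. W $ i $ j \<ge> 0"
  shows "(laplacian W *v z) $ i = (\<Sum>j\<in>UNIV. W $ i $ j * (z $ i - z $ j))"
proof -
  \<comment> \<open>Off the neighbor set a weight is both nonnegative and not positive, so the
    degree may be summed over all agents. A diagonal weight enters degree and \<open>W\<close> alike
    and cancels.\<close>
  have n: "(\<Sum>l\<in>neighbors W i. W $ i $ l) = (\<Sum>l\<in>UNIV. W $ i $ l)"
    by (rule sum.mono_neutral_left) (auto simp: neighbors_def, smt (verit, best) assms)
  have "(laplacian W *v z) $ i = (\<Sum>j\<in>UNIV. (if i = j then \<Sum>l\<in>UNIV. W $ i $ l else 0) * z $ j - W $ i $ j * z $ j)"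
    unfolding n[symmetric] by (simp add: matrix_vector_mult_def laplacian_def left_diff_distrib)
  also have "\<dots> = (\<Sum>l\<in>UNIV. W $ i $ l) * z $ i - (\<Sum>j\<in>UNIV. W $ i $ j * z $ j)"
    by (simp add: sum_subtractf if_distrib[of "\<lambda>c. c * _"] cong: if_cong)
  also have "\<dots> = (\<Sum>j\<in>UNIV. W $ i $ j * (z $ i - z $ j))"
    by (simp add: sum_distrib_right right_diff_distrib sum_subtractf)
  finally show ?thesis .
qed

text \<open>Exchanging the names of \<open>i\<close> and \<open>j\<close> and adding the two copies
  completes the square. Vector values are allowed so that the identity serves both the scalar
  Laplacian form and the diffusion of stacked states.\<close>

lemma symmetric_sum_difference:
  fixes y :: "'m::finite \<Rightarrow> 'a::real_inner"
  assumes "\<And>i j. W $ i $ j = W $ j $ i"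
  shows "(\<Sum>i\<in>UNIV. y i \<bullet> (\<Sum>j\<in>UNIV. W $ i $ j *\<^sub>R (y i - y j)))
    = (\<Sum>i\<in>UNIV. \<Sum>j\<in>UNIV. W $ i $ j * (norm (y i - y j))\<^sup>2) / 2"
proof -
  let ?S = "\<Sum>i\<in>UNIV. \<Sum>j\<in>UNIV. W $ i $ j * (y i \<bullet> (y i - y j))"
  have "?S = (\<Sum>j\<in>UNIV. \<Sum>i\<in>UNIV. W $ i $ j * (y i \<bullet> (y i - y j)))"
    by (rule sum.swap)
  also have "\<dots> = (\<Sum>i\<in>UNIV. \<Sum>j\<in>UNIV. W $ i $ j * (y j \<bullet> (y j - y i)))"
    by (simp add: assms)
  finally have "?S + (\<Sum>i\<in>UNIV. \<Sum>j\<in>UNIV. W $ i $ j * (y j \<bullet> (y j - y i))) = 2 * ?S" by simp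
  moreover have "?S + (\<Sum>i\<in>UNIV. \<Sum>j\<in>UNIV. W $ i $ j * (y j \<bullet> (y j - y i))) = (\<Sum>i\<in>UNIV. \<Sum>j\<in>UNIV. W $ i $ j * (norm (y i - y j))\<^sup>2)"
    by (simp only: sum.distrib[symmetric])
      (intro sum.cong refl, simp add: power2_norm_eq_inner inner_diff algebra_simps inner_commute)
  ultimately show ?thesis
    by (simp add: inner_sum_right)
qed

lemma laplacian_quadratic_form:
  assumes "\<And>i j. W $ i $ j \<ge> 0" "\<And>i j. W $ i $ j = W $ j $ i"
  shows "z \<bullet> (laplacian W *v z) = (\<Sum>i\<in>UNIV. \<Sum>j\<in>UNIV. W $ i $ j * (z $ i - z $ j)\<^sup>2) / 2"
  using symmetric_sum_difference[of W "\<lambda>i. z $ i", OF assms(2)]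
  by (simp add: inner_vec_def laplacian_mult_nth[OF assms(1)])

text \<open>Multiplicities of roots are informative only for a nonzero polynomial. The Laplacian is
  positive semidefinite, so -1 is not an eigenvalue and the polynomial does not vanish
  there.\<close>

lemma charpoly_laplacian_nonzero:
  assumes "\<And>i j. W $ i $ j \<ge> 0" "\<And>i j. W $ i $ j = W $ j $ i"
  shows "charpoly (laplacian W) \<noteq> 0"
proof -
  let ?A = "(\<chi> i j. (if i = j then -1 else 0) - laplacian W $ i $ j)"
  have mv: "?A *v z = - z - laplacian W *v z" for z
    by (simp add: vec_eq_iff matrix_vector_mult_def left_diff_distrib sum_subtractf
        if_distrib[of "\<lambda>c. c * _"] cong: if_cong)
  have "z = 0" if "?A *v z = 0" for z
  proof -
    have "- z = laplacian W *v z" using that mv[of z] by simp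
    then have "- (z \<bullet> z) = z \<bullet> (laplacian W *v z)" by (metis inner_minus_right)
    also have "\<dots> \<ge> 0"
      unfolding laplacian_quadratic_form[OF assms] by (intro divide_nonneg_nonneg sum_nonneg) (auto simp: assms(1))
    finally show ?thesis by (metis inner_eq_zero_iff inner_ge_zero neg_0_le_iff_le order_antisym)
  qed
  then have "invertible ?A"
    by (meson invertible_left_inverse matrix_left_invertible_ker)
  then have "poly (charpoly (laplacian W)) (-1) \<noteq> 0"
    by (simp add: poly_charpoly invertible_det_nz)
  then show ?thesis by auto
qed

text \<open>Two applications of Cramer's rule replace the columns \<open>a\<close> and \<open>b\<close> of \<open>tI - A\<close> by \<open>t\<close> times kernel vectors.\<close>

lemma square_dvd_charpoly:
  fixes A :: "real^'n^'n" and v :: "real^'n"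
  assumes "A *v 1 = 0" "A *v v = 0" "v $ a \<noteq> v $ b"
  shows "[:0, 1:]\<^sup>2 dvd charpoly A"
proof -
  \<comment> \<open>Subtracting a constant vector stays in the kernel and makes entry
    \<open>a\<close> vanish, so the first column replacement, at \<open>a\<close>, will not affect
    the product with \<open>z\<close>.\<close>
  define z :: "real^'n" where "z = v - (\<chi> i. v $ a)"
  have z: "z $ a = 0" "z $ b \<noteq> 0" "a \<noteq> b"
    using assms(3) by (auto simp: z_def)
  have "(\<chi> i. v $ a) = v $ a *s (1 :: real^'n)" by (simp add: vec_eq_iff)
  then have Az: "A *v z = 0"
    by (simp add: z_def matrix_vector_mult_diff_distrib assms matrix_vector_mult_scaleR scalar_mult_eq_scaleR)
  \<comment> \<open>The cofactor left after pulling one factor \<open>t\<close> out of each of the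
    two replaced columns. It is built with polynomial entries, so that the divisibility holds
    between polynomials.\<close>
  define q where "q = det (\<chi> i j. if j = b then [:z $ i:] else if j = a then 1 else
     (if i = j then [:0, 1:] else 0) - [:A $ i $ j:])"
  have "poly (smult (z $ b) (charpoly A)) t = poly ([:0, 1:]\<^sup>2 * q) t" for t
  proof -
    define B :: "real^'n^'n" where "B = (\<chi> i j. (if i = j then t else 0) - A $ i $ j)"
    have Bv: "B *v y = t *s y - A *v y" for y
      by (simp add: B_def vec_eq_iff matrix_vector_mult_def left_diff_distrib sum_subtractf
          if_distrib[of "\<lambda>c. c * _"] cong: if_cong)
    define B1 :: "real^'n^'n" where "B1 = (\<chi> i j. if j = a then (B *v 1) $ i else B $ i $ j)"
    \<comment> \<open>The vector 1 has entry 1 at \<open>a\<close>, so the first replacement keeps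
      the determinant; the second, by \<open>z\<close>, multiplies it by the nonzero entry at
      \<open>b\<close>.\<close>
    have 1: "det B1 = det B"
      using cramer_lemma[of a B 1] by (simp add: B1_def)
    have B1v: "B1 *v z = t *s z"
    proof -
      have "B1 *v z = B *v z"
        by (simp add: vec_eq_iff matrix_vector_mult_def B1_def) (intro allI sum.cong, auto simp: z)
      then show ?thesis by (simp add: Bv Az)
    qed
    have "z $ b * det B = det (\<chi> i j. if j = b then (B1 *v z) $ i else B1 $ i $ j)"
      using cramer_lemma[of b B1 z] 1 by simp
    \<comment> \<open>Transposition makes the two replaced columns, now \<open>t\<close> times
      \<open>z\<close> and \<open>t\<close> times 1, into rows from which the scalars can be
      extracted.\<close>
    also have "\<dots> = det (transpose (\<chi> i. if i = b then t *s z else if i = a then t *s 1 else column i B))"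
      unfolding B1v by (intro arg_cong[of _ _ det])
        (use z in \<open>auto simp: vec_eq_iff transpose_def B1_def[unfolded Bv assms] column_def\<close>)
    also have "\<dots> = t * det (\<chi> i. if i = b then z else if i = a then t *s 1 else column i B)"
      unfolding det_transpose by (rule det_row_mul)
    also have "(\<chi> i. if i = b then z else if i = a then t *s 1 else column i B)
        = (\<chi> i. if i = a then t *s 1 else if i = b then z else column i B)"
      using z by (simp add: vec_eq_iff)
    also have "det \<dots> = t * det (\<chi> i. if i = a then 1 else if i = b then z else column i B)"
      by (rule det_row_mul)
    also have "det (\<chi> i. if i = a then 1 else if i = b then z else column i B) =
        det (transpose (\<chi> i. if i = a then 1 else if i = b then z else column i B))"
      by simp
    also have "transpose (\<chi> i. if i = a then 1 else if i = b then z else column i B)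
        = (\<chi> i j. poly (if j = b then [:z $ i:] else if j = a then 1 else
            (if i = j then [:0, 1:] else 0) - [:A $ i $ j:]) t)"
      using z by (simp add: vec_eq_iff transpose_def column_def B_def)
    finally have "z $ b * det B = t * (t * poly q t)"
      by (simp add: q_def poly_det)
    then show ?thesis
      by (simp add: poly_charpoly B_def power2_eq_square mult.assoc)
  qed
  then have "smult (z $ b) (charpoly A) = [:0, 1:]\<^sup>2 * q"
    by (metis poly_eq_poly_eq_iff ext)
  then show ?thesis
    by (metis dvd_smult_cancel dvd_triv_left z(2))
qed

text \<open>A root 0 of multiplicity two occupies two places of the sorted list, so the entry at
  index 1 is at most 0. Smaller roots may precede it, hence an inequality.\<close>

lemma second_smallest_eigenvalue_nonpos:
  assumes "charpoly A \<noteq> 0" "[:0, 1:]\<^sup>2 dvd charpoly A"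
  shows "second_smallest_eigenvalue A \<le> 0"
proof -
  let ?P = "proots (charpoly A)"
  define l where "l = sorted_list_of_multiset ?P"
  have s: "sorted l" "mset l = ?P" by (simp_all add: l_def)
  have "order 0 (charpoly A) \<ge> 2"
    using assms order_divides[of 0 2 "charpoly A"] by simp
  then have "count (mset l) 0 \<ge> 2" by (simp add: s assms)
  then have c: "count_list l 0 \<ge> 2" by (simp add: count_mset)
  show ?thesis
  proof (cases l)
    case Nil then show ?thesis using c by simp
  next
    case (Cons p l')
    show ?thesis
    proof (cases l')
      case Nil then show ?thesis using c Cons by (simp split: if_splits)
    next
      case (Cons q l'')
      \<comment> \<open>At most one of the two zeros is the head, so the tail contains a zero and
        its first element is no larger.\<close>
      have "0 \<in> set l'"
        using c \<open>l = p # l'\<close> by (cases "0 \<in> set l'") (auto split: if_splits)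
      then have "q \<le> 0" using s(1) \<open>l = p # l'\<close> Cons by auto
      then show ?thesis using \<open>l = p # l'\<close> Cons by (simp add: second_smallest_eigenvalue_def l_def[symmetric])
    qed
  qed
qed

text \<open>A vanishing quadratic form forces every weighted difference to vanish, so
  \<open>z\<close> lies in the kernel, as does the vector 1. If \<open>z\<close> were not constant,
  0 would be a double root, against connectivity; two different entries also provide the two agents
  that \<open>conn\<close> asks for.\<close>

lemma laplacian_kernel:
  fixes W :: "real^'m^'m"
  assumes W: "\<And>i j. W $ i $ j \<ge> 0" "\<And>i j. W $ i $ j = W $ j $ i"
    and conn: "CARD('m) \<ge> 2 \<Longrightarrow> second_smallest_eigenvalue (laplacian W) > 0"
    and z: "z \<bullet> (laplacian W *v z) = 0"
  shows "z $ a = z $ b"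
proof (rule ccontr)
  assume ab: "z $ a \<noteq> z $ b"
  then have "a \<noteq> b" by auto
  then have "card {a, b} = 2" by simp
  then have card: "CARD('m) \<ge> 2" by (metis card_mono finite_class.finite_UNIV subset_UNIV)
  have "(\<Sum>i\<in>UNIV. \<Sum>j\<in>UNIV. W $ i $ j * (z $ i - z $ j)\<^sup>2) = 0"
    using z laplacian_quadratic_form[OF W] by simp
  then have "\<forall>i. (\<Sum>j\<in>UNIV. W $ i $ j * (z $ i - z $ j)\<^sup>2) = 0"
    by (subst (asm) sum_nonneg_eq_0_iff) (auto intro!: sum_nonneg simp: W(1))
  then have "\<forall>i j. W $ i $ j * (z $ i - z $ j)\<^sup>2 = 0"
    by (subst (asm) sum_nonneg_eq_0_iff) (auto simp: W(1))
  then have "W $ i $ j * (z $ i - z $ j) = 0" for i j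
    by (simp add: power2_eq_square)
  then have "laplacian W *v z = 0"
    by (simp only: vec_eq_iff laplacian_mult_nth[OF W(1)]) simp
  moreover have "laplacian W *v 1 = 0"
    by (simp add: vec_eq_iff laplacian_mult_nth[OF W(1)])
  ultimately show False
    using square_dvd_charpoly[OF _ _ ab] second_smallest_eigenvalue_nonpos charpoly_laplacian_nonzero[OF W] conn[OF card]
    by (metis not_less)
qed

text \<open>The constant is the minimum of the quadratic form over unit vectors of sum zero, a
  compact set on which the form is positive. It is not identified with the eigenvalue, as only its
  positivity matters later.\<close>

lemma laplacian_spectral_gap:
  fixes W :: "real^'m^'m"
  assumes W: "\<And>i j. W $ i $ j \<ge> 0" "\<And>i j. W $ i $ j = W $ j $ i"
    and conn: "CARD('m) \<ge> 2 \<Longrightarrow> second_smallest_eigenvalue (laplacian W) > 0"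
  obtains \<rho> where "\<rho> > 0" "\<And>z. (\<Sum>i\<in>UNIV. z $ i) = 0 \<Longrightarrow> \<rho> * (norm z)\<^sup>2 \<le> z \<bullet> (laplacian W *v z)"
proof -
  let ?q = "\<lambda>z. z \<bullet> (laplacian W *v z)"
  define S where "S = sphere 0 1 \<inter> {z :: real^'m. (\<Sum>i\<in>UNIV. z $ i) = 0}"
  have "closed {z :: real^'m. (\<Sum>i\<in>UNIV. z $ i) = 0}"
    by (intro closed_Collect_eq continuous_intros)
  then have "compact S" unfolding S_def by (simp add: compact_Int_closed)
  have unit: "(1 / norm z) *\<^sub>R z \<in> S" if "(\<Sum>i\<in>UNIV. z $ i) = 0" "z \<noteq> 0" for z
    using that by (simp add: S_def sum_divide_distrib[symmetric])
  have q_nonneg: "?q z \<ge> 0" for z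
    unfolding laplacian_quadratic_form[OF W] by (intro divide_nonneg_nonneg sum_nonneg) (auto simp: W(1))
  have q_pos: "?q z > 0" if "z \<in> S" for z
  proof (rule ccontr)
    assume "\<not> ?q z > 0"
    then have "?q z = 0" using q_nonneg[of z] by simp
    then have c: "z $ i = z $ j" for i j using laplacian_kernel[OF W conn] by blast
    have "(\<Sum>i\<in>UNIV. z $ i) = (\<Sum>i\<in>(UNIV::'m set). z $ a)" for a
      by (intro sum.cong refl) (rule c)
    then have "z = 0" using that by (simp add: S_def vec_eq_iff)
    then show False using that by (simp add: S_def)
  qed
  show ?thesis
  proof (cases "S = {}")
    \<comment> \<open>This is the case of a single agent: only the zero vector has sum zero, and any
      positive constant works.\<close>
    case True
    then have "z = 0" if "(\<Sum>i\<in>UNIV. z $ i) = 0" for z :: "real^'m" using unit[of z] that by blast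
    then show ?thesis using that[of 1] by fastforce
  next
    case False
    have "continuous_on S ?q"
      by (intro continuous_intros matrix_vector_mult_linear_continuous_on)
    then obtain z0 where z0: "z0 \<in> S" "\<And>z. z \<in> S \<Longrightarrow> ?q z0 \<le> ?q z"
      using continuous_attains_inf[OF \<open>compact S\<close> False] by blast
    have "?q z0 * (norm z)\<^sup>2 \<le> ?q z" if "(\<Sum>i\<in>UNIV. z $ i) = 0" for z
    proof (cases "z = 0")
      case False
      have "?q z0 \<le> ?q ((1 / norm z) *\<^sub>R z)" using z0(2) unit[OF that False] by blast
      also have "\<dots> = ?q z / (norm z)\<^sup>2" by (simp add: matrix_vector_mult_scaleR power2_eq_square)
      finally show ?thesis using False by (simp add: field_simps)
    qed simp
    then show ?thesis using that q_pos[OF z0(1)] by blast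
  qed
qed

subsection \<open>Diffusion and deviation from the mean\<close>

text \<open>The Laplacian tensored with the identity of the state space, with sign opposite to the
  interaction term of the update. For nonnegative weights, summing over all agents agrees with
  summing over neighbors.\<close>

definition diffusion :: "real^'m^'m \<Rightarrow> 'a::real_vector^'m \<Rightarrow> 'a^'m" where
  "diffusion W y = (\<chi> i. \<Sum>j\<in>UNIV. W $ i $ j *\<^sub>R (y $ i - y $ j))"

text \<open>The orthogonal projection onto the complement of the consensus subspace.\<close>

definition deviation :: "'a::real_vector^'m \<Rightarrow> 'a^'m" where
  "deviation y = (\<chi> i. y $ i - agent_mean (($) y))"

lemma linear_agent_mean: "linear (\<lambda>y :: 'a::real_vector^'m. agent_mean (($) y))"
  by (rule linearI) (simp_all add: agent_mean_def sum.distrib scaleR_right_distrib scaleR_sum_right mult.commute)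

lemma linear_diffusion: "linear (diffusion W)"
  by (rule linearI)
    (simp_all add: diffusion_def vec_eq_iff sum.distrib[symmetric] scaleR_sum_right algebra_simps)

lemma linear_deviation: "linear deviation"
  unfolding deviation_def
  by (rule linearI)
    (simp_all add: vec_eq_iff linear_add[OF linear_agent_mean] linear_cmul[OF linear_agent_mean] algebra_simps)

text \<open>Conservation of the mean: what an edge adds at one end it removes at the other. The
  argument \<open>y\<close> is arbitrary, so this covers quantized states as well.\<close>

lemma agent_mean_diffusion:
  assumes "\<And>i j. W $ i $ j = W $ j $ i"
  shows "agent_mean (($) (diffusion W y)) = 0"
proof -
  let ?S = "\<Sum>i\<in>UNIV. \<Sum>j\<in>UNIV. W $ i $ j *\<^sub>R (y $ i - y $ j)"
  have "?S = (\<Sum>j\<in>UNIV. \<Sum>i\<in>UNIV. W $ i $ j *\<^sub>R (y $ i - y $ j))" by (rule sum.swap)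
  also have "\<dots> = (\<Sum>j\<in>UNIV. \<Sum>i\<in>UNIV. - (W $ j $ i *\<^sub>R (y $ j - y $ i)))"
    by (intro sum.cong refl) (simp add: assms[of _ "_ :: 'a"] algebra_simps)
  also have "\<dots> = - ?S" by (simp add: sum_negf)
  finally have "?S = 0" by (simp add: real_vector.scale_eq_0_iff eq_neg_iff_add_eq_0 scaleR_2[symmetric])
  then show ?thesis by (simp add: agent_mean_def diffusion_def)
qed

lemma agent_mean_deviation: "agent_mean (($) (deviation y)) = 0"
  by (simp add: agent_mean_def deviation_def sum_subtractf scaleR_diff_right sum_constant_scaleR)

lemma deviation_diffusion:
  "(\<And>i j. W $ i $ j = W $ j $ i) \<Longrightarrow> deviation (diffusion W y) = diffusion W y"
  by (simp add: deviation_def agent_mean_diffusion vec_eq_iff)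

lemma diffusion_deviation: "diffusion W (deviation y) = diffusion W y"
  by (simp add: diffusion_def deviation_def)

text \<open>Pythagoras for the projection onto consensus: deviations sum to zero, so the cross term
  vanishes. The consensus part repeats the mean in every block, whence the factor.\<close>

lemma norm_deviation:
  fixes y :: "'a::real_inner^'m"
  shows "(norm y)\<^sup>2 = (norm (deviation y))\<^sup>2 + CARD('m) * (norm (agent_mean (($) y)))\<^sup>2"
proof -
  let ?c = "agent_mean (($) y)"
  have s: "(\<Sum>i\<in>UNIV. deviation y $ i) = 0"
    using agent_mean_deviation[of y] by (simp add: agent_mean_def)
  have "y $ i \<bullet> y $ i = deviation y $ i \<bullet> deviation y $ i + 2 * (deviation y $ i \<bullet> ?c) + ?c \<bullet> ?c" for i
    by (simp add: deviation_def inner_diff inner_commute)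
  then have "y \<bullet> y = deviation y \<bullet> deviation y + 2 * ((\<Sum>i\<in>UNIV. deviation y $ i) \<bullet> ?c) + CARD('m) * (?c \<bullet> ?c)"
    by (simp add: inner_vec_def sum.distrib inner_sum_left sum_distrib_left)
  then show ?thesis by (simp add: s power2_norm_eq_inner)
qed

lemma norm_agent_mean_le:
  fixes y :: "'a::real_inner^'m"
  shows "(norm (agent_mean (($) y)))\<^sup>2 \<le> (norm y)\<^sup>2"
proof -
  have "1 * (norm (agent_mean (($) y)))\<^sup>2 \<le> CARD('m) * (norm (agent_mean (($) y)))\<^sup>2"
    by (intro mult_right_mono) (auto simp: Suc_leI)
  then show ?thesis using norm_deviation[of y] zero_le_power2[of "norm (deviation y)"] by linarith
qed

lemma norm_deviation_le: "(norm (deviation y))\<^sup>2 \<le> (norm (y :: 'a::real_inner^'m))\<^sup>2"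
  using norm_deviation[of y] by simp

text \<open>For each basis vector \<open>b\<close> the slice \<open>z b\<close> of the deviation is
  a scalar vector of sum zero. The scalar gap applies to it, and summing over the basis restores the
  vector norms.\<close>

lemma diffusion_spectral_gap:
  fixes W :: "real^'m^'m"
  assumes W: "\<And>i j. W $ i $ j \<ge> 0" "\<And>i j. W $ i $ j = W $ j $ i"
    and conn: "CARD('m) \<ge> 2 \<Longrightarrow> second_smallest_eigenvalue (laplacian W) > 0"
  obtains \<rho> where "\<rho> > 0"
    "\<And>y :: 'a::euclidean_space^'m. \<rho> * (norm (deviation y))\<^sup>2 \<le> deviation y \<bullet> diffusion W y"
proof -
  obtain \<rho> where \<rho>: "\<rho> > 0" "\<And>z. (\<Sum>i\<in>UNIV. z $ i) = 0 \<Longrightarrow> \<rho> * (norm z)\<^sup>2 \<le> z \<bullet> (laplacian W *v z)"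
    using laplacian_spectral_gap[OF assms] by blast
  have "\<rho> * (norm (deviation y))\<^sup>2 \<le> deviation y \<bullet> diffusion W y" for y :: "'a^'m"
  proof -
    define v where "v = deviation y"
    define z where "z b = (\<chi> i. v $ i \<bullet> b)" for b
    have s: "(\<Sum>i\<in>UNIV. v $ i) = 0"
      using agent_mean_deviation[of y] by (simp add: agent_mean_def v_def)
    have sq: "(norm x)\<^sup>2 = (\<Sum>b\<in>Basis. (x \<bullet> b)\<^sup>2)" for x :: 'a
      unfolding power2_norm_eq_inner euclidean_inner[of x x] by (simp add: power2_eq_square)
    have nz: "(norm v)\<^sup>2 = (\<Sum>b\<in>Basis. (norm (z b))\<^sup>2)"
    proof -
      have "(norm v)\<^sup>2 = (\<Sum>i\<in>UNIV. \<Sum>b\<in>Basis. (v $ i \<bullet> b)\<^sup>2)"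
        unfolding sq[symmetric] by (simp add: power2_norm_eq_inner inner_vec_def)
      also have "\<dots> = (\<Sum>b\<in>Basis. \<Sum>i\<in>UNIV. (v $ i \<bullet> b)\<^sup>2)" by (rule sum.swap)
      finally show ?thesis unfolding power2_norm_eq_inner by (simp add: inner_vec_def z_def power2_eq_square)
    qed
    have "\<rho> * (norm v)\<^sup>2 = (\<Sum>b\<in>Basis. \<rho> * (norm (z b))\<^sup>2)"
      by (simp add: nz sum_distrib_left)
    also have "\<dots> \<le> (\<Sum>b\<in>Basis. z b \<bullet> (laplacian W *v z b))"
      by (intro sum_mono \<rho>(2)) (simp add: z_def inner_sum_left[symmetric] s)
    also have "\<dots> = (\<Sum>b\<in>Basis. (\<Sum>i\<in>UNIV. \<Sum>j\<in>UNIV. W $ i $ j * ((v $ i - v $ j) \<bullet> b)\<^sup>2)) / 2"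
      unfolding laplacian_quadratic_form[OF W] by (simp add: z_def inner_diff_left sum_divide_distrib)
    also have "(\<Sum>b\<in>(Basis :: 'a set). (\<Sum>i\<in>UNIV. \<Sum>j\<in>UNIV. W $ i $ j * ((v $ i - v $ j) \<bullet> b)\<^sup>2)) =
        (\<Sum>i\<in>UNIV. \<Sum>j\<in>UNIV. \<Sum>b\<in>Basis. W $ i $ j * ((v $ i - v $ j) \<bullet> b)\<^sup>2)"
      by (subst sum.swap, subst (2) sum.swap) (rule refl)
    also have "\<dots> / 2 = v \<bullet> diffusion W v"
      using symmetric_sum_difference[of W "($) v", OF W(2)]
      by (simp add: sq sum_distrib_left[symmetric] inner_vec_def diffusion_def)
    finally show ?thesis by (simp add: v_def diffusion_deviation)
  qed
  then show ?thesis using that \<rho>(1) by blast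
qed

text \<open>The paper's \<open>\<lambda>\<close> is called \<open>\<alpha>\<close> from here on, as \<open>\<lambda>\<close> is reserved syntax.\<close>

lemma damped_step_norm:
  fixes y l h :: "'a::real_inner"
  assumes "\<rho> > 0" "\<epsilon> \<ge> 0" and gap: "\<rho> * (norm y)\<^sup>2 \<le> y \<bullet> l" and B: "(norm l)\<^sup>2 \<le> B * (norm y)\<^sup>2"
  shows "(norm (y - \<epsilon> *\<^sub>R l - (\<epsilon> * \<alpha>) *\<^sub>R h))\<^sup>2
    \<le> (1 - \<rho> * \<epsilon> + 2 * B * \<epsilon>\<^sup>2) * (norm y)\<^sup>2 + (\<epsilon> / \<rho> + 2 * \<epsilon>\<^sup>2) * (\<alpha>\<^sup>2 * (norm h)\<^sup>2)"
proof -
  have 1: "(norm (y - \<epsilon> *\<^sub>R l - (\<epsilon> * \<alpha>) *\<^sub>R h))\<^sup>2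
      = (norm y)\<^sup>2 - 2 * \<epsilon> * (y \<bullet> l) - 2 * \<epsilon> * (\<alpha> * (y \<bullet> h)) + \<epsilon>\<^sup>2 * (norm (l + \<alpha> *\<^sub>R h))\<^sup>2"
    unfolding power2_norm_eq_inner by (simp add: inner_diff inner_add inner_commute power2_eq_square algebra_simps)
  have "0 \<le> (norm (\<rho> *\<^sub>R y + \<alpha> *\<^sub>R h))\<^sup>2 / \<rho>" using assms by simp
  then have "- 2 * (\<alpha> * (y \<bullet> h)) \<le> \<rho> * (norm y)\<^sup>2 + \<alpha>\<^sup>2 * (norm h)\<^sup>2 / \<rho>"
    using \<open>\<rho> > 0\<close> unfolding power2_norm_eq_inner by (simp add: inner_add inner_commute power2_eq_square field_simps)
  from mult_left_mono[OF this \<open>\<epsilon> \<ge> 0\<close>]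
  have 2: "- 2 * \<epsilon> * (\<alpha> * (y \<bullet> h)) \<le> \<epsilon> * (\<rho> * (norm y)\<^sup>2) + \<epsilon> * (\<alpha>\<^sup>2 * (norm h)\<^sup>2 / \<rho>)"
    by (simp add: algebra_simps)
  have 3: "2 * \<epsilon> * (\<rho> * (norm y)\<^sup>2) \<le> 2 * \<epsilon> * (y \<bullet> l)"
    using gap \<open>\<epsilon> \<ge> 0\<close> by (intro mult_left_mono) auto
  have "0 \<le> (norm (l - \<alpha> *\<^sub>R h))\<^sup>2" by simp
  then have "(norm (l + \<alpha> *\<^sub>R h))\<^sup>2 \<le> 2 * (norm l)\<^sup>2 + 2 * (\<alpha>\<^sup>2 * (norm h)\<^sup>2)"
    unfolding power2_norm_eq_inner by (simp add: inner_add inner_diff inner_commute power2_eq_square algebra_simps)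
  also have "\<dots> \<le> 2 * (B * (norm y)\<^sup>2) + 2 * (\<alpha>\<^sup>2 * (norm h)\<^sup>2)" using B by simp
  finally have 4: "\<epsilon>\<^sup>2 * (norm (l + \<alpha> *\<^sub>R h))\<^sup>2 \<le> \<epsilon>\<^sup>2 * (2 * (B * (norm y)\<^sup>2) + 2 * (\<alpha>\<^sup>2 * (norm h)\<^sup>2))"
    by (intro mult_left_mono) auto
  show ?thesis using 1 2 3 4 by (simp add: algebra_simps)
qed

text \<open>Convexity of the squared norm with weights proportional to \<open>T\<close> and
  \<open>c\<close>; the defect is exactly \<open>c / T\<close> times the squared norm of
  \<open>p - T q\<close>. The form is chosen so that bounds \<open>d * T\<^sup>2\<close> on
  \<open>p\<close> and \<open>d\<close> on \<open>q\<close> combine to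
  \<open>d * (T + c)\<^sup>2\<close>.\<close>

lemma norm_add_scaleR_square_le:
  fixes p q :: "'a::real_inner"
  assumes "T > 0" "c \<ge> 0"
  shows "(norm (p + c *\<^sub>R q))\<^sup>2 \<le> (T + c) * ((norm p)\<^sup>2 / T + c * (norm q)\<^sup>2)"
proof -
  have "0 \<le> c / T * (norm (p - T *\<^sub>R q))\<^sup>2" using assms by simp
  then show ?thesis using assms
    unfolding power2_norm_eq_inner by (simp add: inner_add inner_diff inner_commute power2_eq_square field_simps)
qed

subsection \<open>Real recursions and weighted averages\<close>

text \<open>Once \<open>c * \<epsilon> k\<close> is below \<open>\<rho> / 2\<close>, half of the
  damping absorbs the growth term, and the other half telescopes. The finitely many earlier indices
  go into \<open>A\<close>.\<close>

lemma damped_recursion_sum: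
  fixes u r \<epsilon> :: "nat \<Rightarrow> real"
  assumes "\<rho> > 0" and u: "\<And>k. u k \<ge> 0" and \<epsilon>: "\<And>k. \<epsilon> k \<ge> 0" "\<epsilon> \<longlonglongrightarrow> 0" and r: "\<And>k. r k \<ge> 0"
    and rec: "\<And>k. u (Suc k) \<le> u k - \<rho> * \<epsilon> k * u k + c * (\<epsilon> k)\<^sup>2 * u k + r k"
  obtains A where "\<And>t. (\<Sum>k<t. \<epsilon> k * u k) \<le> A + 2 / \<rho> * (\<Sum>k<t. r k)"
proof -
  have "(\<lambda>k. c * \<epsilon> k) \<longlonglongrightarrow> c * 0" by (intro tendsto_intros \<epsilon>)
  then have "eventually (\<lambda>k. c * \<epsilon> k < \<rho> / 2) sequentially"
    using \<open>\<rho> > 0\<close> by (intro order_tendstoD) auto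
  then obtain K where K: "\<And>k. k \<ge> K \<Longrightarrow> c * \<epsilon> k < \<rho> / 2" by (auto simp: eventually_sequentially)
  define A where "A = (\<Sum>k<K. \<epsilon> k * u k) + 2 / \<rho> * u K"
  have drop: "\<epsilon> k * u k \<le> 2 / \<rho> * (u k - u (Suc k) + r k)" if "k \<ge> K" for k
  proof -
    have "c * \<epsilon> k * (\<epsilon> k * u k) \<le> \<rho> / 2 * (\<epsilon> k * u k)"
      using K[OF that] u \<epsilon> by (intro mult_right_mono) auto
    then have "\<rho> / 2 * (\<epsilon> k * u k) \<le> u k - u (Suc k) + r k"
      using rec[of k] by (simp add: power2_eq_square algebra_simps)
    then show ?thesis using \<open>\<rho> > 0\<close> by (simp add: field_simps)
  qed
  \<comment> \<open>The potential \<open>2 / \<rho> * u t\<close> is kept on the left so that the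
    telescoping runs as an induction from \<open>K\<close>.\<close>
  have late: "(\<Sum>k<t. \<epsilon> k * u k) + 2 / \<rho> * u t \<le> A + 2 / \<rho> * (\<Sum>k<t. r k)" if "t \<ge> K" for t
    using that
  proof (induction t rule: dec_induct)
    case base
    then show ?case using \<open>\<rho> > 0\<close> r by (simp add: A_def sum_nonneg)
  next
    case (step t)
    show ?case using step.IH drop[OF step.hyps(1)]
      by (simp add: algebra_simps diff_divide_distrib add_divide_distrib)
  qed
  have nn: "0 \<le> 2 / \<rho> * (\<Sum>k<t. r k)" "0 \<le> 2 / \<rho> * u t" for t
    using \<open>\<rho> > 0\<close> r u by (simp_all add: sum_nonneg)
  have "(\<Sum>k<t. \<epsilon> k * u k) \<le> A + 2 / \<rho> * (\<Sum>k<t. r k)" for t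
  proof (cases "t \<ge> K")
    case True
    then show ?thesis using late[OF True] nn(2)[of t] by linarith
  next
    case False
    then have "(\<Sum>k<t. \<epsilon> k * u k) \<le> (\<Sum>k<K. \<epsilon> k * u k)"
      using u \<epsilon> by (intro sum_mono2) auto
    then show ?thesis using nn(1)[of t] nn(2)[of K] by (simp add: A_def)
  qed
  then show ?thesis using that by blast
qed

text \<open>Kronecker's lemma for nonnegative terms: the part of the sum before \<open>N\<close> is
  fixed while \<open>V\<close> diverges, and in the rest \<open>V k\<close> is replaced by
  \<open>V t\<close> against a small tail of the series.\<close>

lemma weighted_partial_sum_tendsto_0:
  fixes a V :: "nat \<Rightarrow> real"
  assumes a: "summable a" "\<And>k. a k \<ge> 0" and V: "mono V" "\<And>k. V k \<ge> 0" "filterlim V at_top sequentially"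
  shows "(\<lambda>t. (\<Sum>k<t. a k * V k) / V t) \<longlonglongrightarrow> 0"
proof (rule LIMSEQ_I)
  fix e :: real assume "e > 0"
  obtain N where N: "norm (sum a {m..<n}) < e / 2" if "m \<ge> N" for m n
    using a(1) \<open>e > 0\<close> unfolding summable_Cauchy by (meson half_gt_zero)
  define b where "b = (\<Sum>k<N. a k * V k)"
  have "eventually (\<lambda>t. V t > max 0 (2 * b / e)) sequentially"
    using V(3) unfolding filterlim_at_top_dense by blast
  then obtain N' where N': "V t > max 0 (2 * b / e)" if "t \<ge> N'" for t
    by (auto simp: eventually_sequentially)
  have "norm ((\<Sum>k<t. a k * V k) / V t - 0) < e" if t: "t \<ge> max N N'" for t
  proof -
    have "(\<Sum>k<t. a k * V k) = b + (\<Sum>k=N..<t. a k * V k)"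
      unfolding b_def using t sum.atLeastLessThan_concat[of 0 N t "\<lambda>k. a k * V k"] by (simp add: atLeast0LessThan)
    also have "(\<Sum>k=N..<t. a k * V k) \<le> (\<Sum>k=N..<t. a k * V t)"
      using a V(1) by (intro sum_mono mult_left_mono) (auto intro: monoD)
    also have "\<dots> \<le> e / 2 * V t"
      unfolding sum_distrib_right[symmetric] using N[of N t] V(2)[of t] by (intro mult_right_mono) auto
    also have "b < e / 2 * V t"
      using N'[of t] t \<open>e > 0\<close> by (auto simp: field_simps)
    finally have "(\<Sum>k<t. a k * V k) < e * V t" by simp
    moreover have "V t > 0" using N'[of t] t by simp
    moreover have "0 \<le> (\<Sum>k<t. a k * V k)" using a V by (intro sum_nonneg) auto
    ultimately show ?thesis by (simp add: divide_less_eq)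
  qed
  then show "\<exists>no. \<forall>n\<ge>no. norm ((\<Sum>k<n. a k * V k) / V n - 0) < e" by blast
qed

text \<open>Both upper bounds on \<open>d\<close> are applied at once: their product makes
  \<open>\<epsilon> k * (d k)\<^sup>2\<close> a multiple of \<open>\<epsilon> k * u k\<close>, whose
  partial sums are \<open>o\<close> of the square of \<open>T\<close>. The weight is split as
  \<open>sqrt (\<epsilon> k)\<close> times itself for the Cauchy-Schwarz inequality.\<close>

lemma weighted_average_error_tendsto_0:
  fixes u d \<epsilon> \<alpha> :: "nat \<Rightarrow> real"
  defines "T \<equiv> \<lambda>t. \<Sum>k<t. \<epsilon> k * \<alpha> k"
  assumes pos: "\<And>k. \<epsilon> k > 0" "\<And>k. \<alpha> k > 0"
    and T: "filterlim T at_top sequentially"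
    and sum: "summable (\<lambda>k. (\<epsilon> k)\<^sup>2)" "summable (\<lambda>k. \<epsilon> k * (\<alpha> k)\<^sup>2)"
    and "\<rho> > 0" and u: "\<And>k. u k \<ge> 0" and c: "c2 \<ge> 0" "c3 \<ge> 0" 
    and rec: "\<And>k. u (Suc k) \<le> u k - \<rho> * \<epsilon> k * u k + c1 * (\<epsilon> k)\<^sup>2 * u k
      + (c2 * (\<epsilon> k * (\<alpha> k)\<^sup>2) + c3 * ((\<epsilon> k)\<^sup>2 * (T k)\<^sup>2))"
    and d: "\<And>k. 0 \<le> d k" "\<And>k. d k \<le> c4 * u k" "\<And>k. d k \<le> c5"
  shows "(\<lambda>t. (\<Sum>k<t. \<epsilon> k * \<alpha> k * d k) / T t) \<longlonglongrightarrow> 0"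
proof -
  have T0: "T k \<ge> 0" for k unfolding T_def using pos by (intro sum_nonneg mult_nonneg_nonneg) (auto intro: less_imp_le)
  have "mono T" unfolding T_def
    using pos by (intro monoI sum_mono2) (auto intro: less_imp_le)
  then have mono: "mono (\<lambda>t. (T t)\<^sup>2)" using T0 by (intro monoI power_mono) (auto dest: monoD)
  have T2: "filterlim (\<lambda>t. (T t)\<^sup>2) at_top sequentially"
    by (intro filterlim_pow_at_top T) simp
  have "(\<lambda>k. (\<epsilon> k)\<^sup>2) \<longlonglongrightarrow> 0" using sum(1) by (rule summable_LIMSEQ_zero)
  then have "\<epsilon> \<longlonglongrightarrow> 0" by simp
  define \<Lambda> where "\<Lambda> = (\<Sum>k. \<epsilon> k * (\<alpha> k)\<^sup>2)"
  have \<Lambda>: "(\<Sum>k<t. \<epsilon> k * (\<alpha> k)\<^sup>2) \<le> \<Lambda>" for t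
    unfolding \<Lambda>_def by (rule sum_le_suminf[OF sum(2)]) (auto simp: less_imp_le pos)
  have "\<Lambda> \<ge> 0" using \<Lambda>[of 0] by simp
  obtain A where A: "\<And>t. (\<Sum>k<t. \<epsilon> k * u k) \<le> A + 2 / \<rho> * (\<Sum>k<t. c2 * (\<epsilon> k * (\<alpha> k)\<^sup>2) + c3 * ((\<epsilon> k)\<^sup>2 * (T k)\<^sup>2))"
    by (rule damped_recursion_sum[OF \<open>\<rho> > 0\<close> u _ \<open>\<epsilon> \<longlonglongrightarrow> 0\<close> _ rec]) (use c pos in \<open>auto simp: less_imp_le\<close>)
  define A' where "A' = A + 2 / \<rho> * (c2 * \<Lambda>)"
  \<comment> \<open>Everything of constant order is gathered in \<open>A'\<close>; the only growing
    part is the sum to which Kronecker's lemma applies.\<close>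
  define R where "R t = (A' + 2 / \<rho> * (c3 * (\<Sum>k<t. (\<epsilon> k)\<^sup>2 * (T k)\<^sup>2)))" for t
  have UR: "(\<Sum>k<t. \<epsilon> k * u k) \<le> R t" for t
  proof -
    have "2 / \<rho> * (c2 * (\<Sum>k<t. \<epsilon> k * (\<alpha> k)\<^sup>2)) \<le> 2 / \<rho> * (c2 * \<Lambda>)"
      using c \<Lambda> \<open>\<rho> > 0\<close> by (intro mult_left_mono) auto
    then show ?thesis using A[of t]
      unfolding R_def A'_def sum.distrib sum_distrib_left[symmetric] distrib_left by linarith
  qed
  have "(\<lambda>t. A' / (T t)\<^sup>2 + 2 / \<rho> * (c3 * ((\<Sum>k<t. (\<epsilon> k)\<^sup>2 * (T k)\<^sup>2) / (T t)\<^sup>2))) \<longlonglongrightarrow> 0 + 2 / \<rho> * (c3 * 0)"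
    using weighted_partial_sum_tendsto_0[OF sum(1) _ mono _ T2]
    by (intro tendsto_intros real_tendsto_divide_at_top[OF tendsto_const T2]) auto
  then have "(\<lambda>t. R t / (T t)\<^sup>2) \<longlonglongrightarrow> 0"
    by (simp add: R_def add_divide_distrib)
  then have "(\<lambda>t. \<Lambda> * (\<bar>c5\<bar> * \<bar>c4\<bar> * (R t / (T t)\<^sup>2))) \<longlonglongrightarrow> \<Lambda> * (\<bar>c5\<bar> * \<bar>c4\<bar> * 0)"
    by (intro tendsto_intros)
  from tendsto_real_sqrt[OF this]
  have lim: "(\<lambda>t. sqrt (\<Lambda> * (\<bar>c5\<bar> * \<bar>c4\<bar> * (R t / (T t)\<^sup>2)))) \<longlonglongrightarrow> 0"
    unfolding mult_zero_right real_sqrt_zero .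
  have bound: "(\<Sum>k<t. \<epsilon> k * \<alpha> k * d k) / T t \<le> sqrt (\<Lambda> * (\<bar>c5\<bar> * \<bar>c4\<bar> * (R t / (T t)\<^sup>2)))" for t
  proof -
    have "(\<Sum>k<t. \<epsilon> k * \<alpha> k * d k)\<^sup>2 = (\<Sum>k<t. (sqrt (\<epsilon> k) * \<alpha> k) * (sqrt (\<epsilon> k) * d k))\<^sup>2"
    proof (intro arg_cong[of _ _ "\<lambda>x. x\<^sup>2"] sum.cong refl)
      fix k
      have "\<epsilon> k * \<alpha> k * d k = (sqrt (\<epsilon> k) * sqrt (\<epsilon> k)) * \<alpha> k * d k"
        using pos(1)[of k] by simp
      then show "\<epsilon> k * \<alpha> k * d k = (sqrt (\<epsilon> k) * \<alpha> k) * (sqrt (\<epsilon> k) * d k)"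
        by (simp only: ac_simps)
    qed
    also have "\<dots> \<le> (\<Sum>k<t. (sqrt (\<epsilon> k) * \<alpha> k)\<^sup>2) * (\<Sum>k<t. (sqrt (\<epsilon> k) * d k)\<^sup>2)"
      by (rule Cauchy_Schwarz_ineq_sum)
    also have "\<dots> = (\<Sum>k<t. \<epsilon> k * (\<alpha> k)\<^sup>2) * (\<Sum>k<t. \<epsilon> k * (d k)\<^sup>2)"
      using pos by (simp add: power_mult_distrib less_imp_le)
    also have "\<dots> \<le> \<Lambda> * (\<bar>c5\<bar> * \<bar>c4\<bar> * R t)"
    proof (intro mult_mono \<Lambda> \<open>\<Lambda> \<ge> 0\<close>)
      \<comment> \<open>Absolute values appear because no signs are assumed for \<open>c4\<close>
        and \<open>c5\<close>.\<close>
      have "\<epsilon> k * (d k)\<^sup>2 \<le> \<bar>c5\<bar> * \<bar>c4\<bar> * (\<epsilon> k * u k)" for k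
      proof -
        have "d k \<le> \<bar>c4\<bar> * u k" using d(2)[of k] u[of k] by (smt (verit) mult_right_mono)
        moreover have "d k \<le> \<bar>c5\<bar>" using d(3)[of k] by simp
        ultimately have "d k * d k \<le> \<bar>c5\<bar> * (\<bar>c4\<bar> * u k)" using d(1)[of k] by (intro mult_mono) auto
        then have "\<epsilon> k * (d k * d k) \<le> \<epsilon> k * (\<bar>c5\<bar> * (\<bar>c4\<bar> * u k))"
          using pos(1)[of k] by (intro mult_left_mono) auto
        then show ?thesis by (simp only: power2_eq_square ac_simps)
      qed
      then have "(\<Sum>k<t. \<epsilon> k * (d k)\<^sup>2) \<le> \<bar>c5\<bar> * \<bar>c4\<bar> * (\<Sum>k<t. \<epsilon> k * u k)"
        unfolding sum_distrib_left by (rule sum_mono)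
      also have "\<dots> \<le> \<bar>c5\<bar> * \<bar>c4\<bar> * R t" by (intro mult_left_mono UR) auto
      finally show "(\<Sum>k<t. \<epsilon> k * (d k)\<^sup>2) \<le> \<bar>c5\<bar> * \<bar>c4\<bar> * R t" .
    qed (auto intro!: sum_nonneg simp: less_imp_le pos)
    finally have "(\<Sum>k<t. \<epsilon> k * \<alpha> k * d k)\<^sup>2 / (T t)\<^sup>2 \<le> \<Lambda> * (\<bar>c5\<bar> * \<bar>c4\<bar> * R t) / (T t)\<^sup>2"
      by (rule divide_right_mono) simp
    then show ?thesis by (intro real_le_rsqrt) (simp add: power_divide)
  qed
  show ?thesis
    by (rule real_tendsto_sandwich[OF _ _ tendsto_const lim])
      (use bound T0 d(1) pos in \<open>auto intro!: always_eventually divide_nonneg_nonneg sum_nonneg simp: less_imp_le\<close>)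
qed

text \<open>The potential telescopes and is bounded below, so the weighted sum exceeds that of
  \<open>d\<close> by at most a constant, which disappears on division by \<open>T\<close>. It is
  stated for a generic \<open>a\<close> because it is applied to each of the two gradient
  quantities.\<close>

lemma weighted_average_of_descent_tendsto_0:
  fixes \<Phi> a d \<epsilon> \<alpha> :: "nat \<Rightarrow> real"
  defines "T \<equiv> \<lambda>t. \<Sum>k<t. \<epsilon> k * \<alpha> k"
  assumes pos: "\<And>k. \<epsilon> k > 0" "\<And>k. \<alpha> k > 0"
    and T: "filterlim T at_top sequentially"
    and sum: "summable r"
    and error: "(\<lambda>t. (\<Sum>k<t. \<epsilon> k * \<alpha> k * d k) / T t) \<longlonglongrightarrow> 0"
    and a: "\<And>k. a k \<ge> 0" and lower: "\<And>k. m \<le> \<Phi> k"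
    and descent: "\<And>k. \<epsilon> k * \<alpha> k * a k \<le> \<Phi> k - \<Phi> (Suc k) + \<epsilon> k * \<alpha> k * d k + r k"
  shows "(\<lambda>t. (\<Sum>k<t. \<epsilon> k * \<alpha> k * a k) / T t) \<longlonglongrightarrow> 0"
proof -
  have T0: "T k \<ge> 0" for k unfolding T_def using pos by (intro sum_nonneg mult_nonneg_nonneg) (auto intro: less_imp_le)
  obtain b where b: "\<And>t. norm (\<Sum>k<t. r k) \<le> b"
    using convergent_imp_Bseq[OF sum[unfolded summable_iff_convergent]] unfolding Bseq_def by blast
  have S: "(\<Sum>k<t. \<epsilon> k * \<alpha> k * a k) \<le> (\<Phi> 0 - m + b) + (\<Sum>k<t. \<epsilon> k * \<alpha> k * d k)" for t
  proof -
    have "(\<Sum>k<t. \<epsilon> k * \<alpha> k * a k) \<le> (\<Sum>k<t. \<Phi> k - \<Phi> (Suc k) + \<epsilon> k * \<alpha> k * d k + r k)"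
      by (intro sum_mono descent)
    also have "\<dots> = \<Phi> 0 - \<Phi> t + (\<Sum>k<t. \<epsilon> k * \<alpha> k * d k) + (\<Sum>k<t. r k)"
      by (simp add: sum.distrib sum_lessThan_telescope')
    finally show ?thesis using lower[of t] b[of t] by simp
  qed
  have lim: "(\<lambda>t. (\<Phi> 0 - m + b) / T t + (\<Sum>k<t. \<epsilon> k * \<alpha> k * d k) / T t) \<longlonglongrightarrow> 0 + 0"
    by (intro tendsto_add error real_tendsto_divide_at_top[OF tendsto_const T])
  show ?thesis
  proof (rule real_tendsto_sandwich[OF _ _ tendsto_const])
    show "(\<lambda>t. (\<Phi> 0 - m + b) / T t + (\<Sum>k<t. \<epsilon> k * \<alpha> k * d k) / T t) \<longlonglongrightarrow> 0" using lim by simp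
    show "\<forall>\<^sub>F t in sequentially. 0 \<le> (\<Sum>k<t. \<epsilon> k * \<alpha> k * a k) / T t"
      using T0 a pos by (auto intro!: always_eventually divide_nonneg_nonneg sum_nonneg simp: less_imp_le)
    show "\<forall>\<^sub>F t in sequentially. (\<Sum>k<t. \<epsilon> k * \<alpha> k * a k) / T t
        \<le> (\<Phi> 0 - m + b) / T t + (\<Sum>k<t. \<epsilon> k * \<alpha> k * d k) / T t"
      unfolding add_divide_distrib[symmetric] using S T0 by (intro always_eventually allI divide_right_mono)
  qed
qed

subsection \<open>Square-integrable random vectors\<close>

lemma norm_add_square_le:
  fixes p q :: "'a::real_inner"
  shows "(norm (p + q))\<^sup>2 \<le> 2 * (norm p)\<^sup>2 + 2 * (norm q)\<^sup>2"
  using inner_ge_zero[of "p - q"] unfolding power2_norm_eq_inner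
  by (simp add: inner_add inner_diff inner_commute)

lemma (in prob_space) integrable_norm_square_add:
  fixes f g :: "'a \<Rightarrow> 'b::euclidean_space"
  assumes [measurable]: "random_variable borel f" "random_variable borel g"
    and "integrable M (\<lambda>\<omega>. (norm (f \<omega>))\<^sup>2)" "integrable M (\<lambda>\<omega>. (norm (g \<omega>))\<^sup>2)"
  shows "integrable M (\<lambda>\<omega>. (norm (f \<omega> + g \<omega>))\<^sup>2)"
proof (rule Bochner_Integration.integrable_bound)
  show "integrable M (\<lambda>\<omega>. 2 * (norm (f \<omega>))\<^sup>2 + 2 * (norm (g \<omega>))\<^sup>2)" using assms by auto
  show "AE \<omega> in M. norm ((norm (f \<omega> + g \<omega>))\<^sup>2) \<le> norm (2 * (norm (f \<omega>))\<^sup>2 + 2 * (norm (g \<omega>))\<^sup>2)"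
    by (intro AE_I2) (simp add: norm_add_square_le)
qed measurable

lemma (in prob_space) integrable_inner:
  fixes f g :: "'a \<Rightarrow> 'b::euclidean_space"
  assumes [measurable]: "random_variable borel f" "random_variable borel g"
    and "integrable M (\<lambda>\<omega>. (norm (f \<omega>))\<^sup>2)" "integrable M (\<lambda>\<omega>. (norm (g \<omega>))\<^sup>2)"
  shows "integrable M (\<lambda>\<omega>. f \<omega> \<bullet> g \<omega>)"
proof (rule Bochner_Integration.integrable_bound)
  show "integrable M (\<lambda>\<omega>. (norm (f \<omega>))\<^sup>2 + (norm (g \<omega>))\<^sup>2)" using assms by auto
  have "\<bar>f \<omega> \<bullet> g \<omega>\<bar> \<le> (norm (f \<omega>))\<^sup>2 + (norm (g \<omega>))\<^sup>2" for \<omega>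
    using Cauchy_Schwarz_ineq2[of "f \<omega>" "g \<omega>"] sum_squares_bound[of "norm (f \<omega>)" "norm (g \<omega>)"]
      mult_nonneg_nonneg[OF norm_ge_zero[of "f \<omega>"] norm_ge_zero[of "g \<omega>"]] by linarith
  then show "AE \<omega> in M. norm (f \<omega> \<bullet> g \<omega>) \<le> norm ((norm (f \<omega>))\<^sup>2 + (norm (g \<omega>))\<^sup>2)"
    by (intro AE_I2) simp
qed measurable

lemma (in prob_space) integrable_of_norm_square:
  fixes f :: "'a \<Rightarrow> 'b::euclidean_space"
  assumes [measurable]: "random_variable borel f" and "integrable M (\<lambda>\<omega>. (norm (f \<omega>))\<^sup>2)"
  shows "integrable M f"
proof (rule Bochner_Integration.integrable_bound)
  show "integrable M (\<lambda>\<omega>. 1 + (norm (f \<omega>))\<^sup>2)" using assms by auto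
  have "norm (f \<omega>) \<le> 1 + (norm (f \<omega>))\<^sup>2" for \<omega>
    using sum_squares_bound[of 1 "norm (f \<omega>)"] norm_ge_zero[of "f \<omega>"] unfolding power_one mult_1_right by linarith
  then show "AE \<omega> in M. norm (f \<omega>) \<le> norm (1 + (norm (f \<omega>))\<^sup>2)"
    by (intro AE_I2) simp
qed measurable

lemma (in prob_space) integrable_norm_square_bounded:
  fixes f :: "'a \<Rightarrow> 'b::euclidean_space"
  assumes [measurable]: "random_variable borel f" and "\<And>\<omega>. norm (f \<omega>) \<le> C"
  shows "integrable M (\<lambda>\<omega>. (norm (f \<omega>))\<^sup>2)"
proof (rule integrable_const_bound[of _ "C\<^sup>2"])
  show "AE \<omega> in M. norm ((norm (f \<omega>))\<^sup>2) \<le> C\<^sup>2"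
    using assms(2) by (intro AE_I2) (simp add: power_mono)
qed measurable

lemma borel_measurable_linear:
  fixes A :: "'a::euclidean_space \<Rightarrow> 'b::euclidean_space"
  shows "linear A \<Longrightarrow> A \<in> borel_measurable borel"
  by (intro borel_measurable_continuous_onI linear_continuous_on) (simp add: linear_conv_bounded_linear)

lemma linear_norm_square_bound:
  fixes A :: "'a::euclidean_space \<Rightarrow> 'b::euclidean_space"
  assumes "linear A"
  obtains B where "B \<ge> 0" "\<And>x. (norm (A x))\<^sup>2 \<le> B * (norm x)\<^sup>2"
proof -
  obtain b where b: "\<And>x. norm (A x) \<le> b * norm x" using linear_bounded[OF assms] by blast
  then have "(norm (A x))\<^sup>2 \<le> b\<^sup>2 * (norm x)\<^sup>2" for x
    unfolding power_mult_distrib[symmetric] by (intro power_mono) auto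
  then show ?thesis using that[of "b\<^sup>2"] by simp
qed

lemma (in prob_space) integrable_norm_square_linear:
  fixes f :: "'a \<Rightarrow> 'b::euclidean_space" and A :: "'b \<Rightarrow> 'c::euclidean_space"
  assumes A: "linear A" and [measurable]: "random_variable borel f"
    and f: "integrable M (\<lambda>\<omega>. (norm (f \<omega>))\<^sup>2)"
  shows "integrable M (\<lambda>\<omega>. (norm (A (f \<omega>)))\<^sup>2)"
proof -
  note [measurable] = borel_measurable_linear[OF A]
  obtain B where B: "B \<ge> 0" "\<And>x. (norm (A x))\<^sup>2 \<le> B * (norm x)\<^sup>2" using linear_norm_square_bound[OF A] by blast
  show ?thesis
    by (rule Bochner_Integration.integrable_bound[of _ "\<lambda>\<omega>. B * (norm (f \<omega>))\<^sup>2"])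
      (use f B in \<open>auto intro!: AE_I2\<close>)
qed

lemma (in prob_space) integrable_norm_square_scaleR:
  fixes f :: "'a \<Rightarrow> 'b::euclidean_space"
  shows "integrable M (\<lambda>\<omega>. (norm (f \<omega>))\<^sup>2) \<Longrightarrow> integrable M (\<lambda>\<omega>. (norm (c *\<^sub>R f \<omega>))\<^sup>2)"
  by (simp add: power_mult_distrib)

lemma (in prob_space) integrable_norm_square_diff:
  fixes f g :: "'a \<Rightarrow> 'b::euclidean_space"
  assumes "random_variable borel f" "random_variable borel g"
    and "integrable M (\<lambda>\<omega>. (norm (f \<omega>))\<^sup>2)" "integrable M (\<lambda>\<omega>. (norm (g \<omega>))\<^sup>2)"
  shows "integrable M (\<lambda>\<omega>. (norm (f \<omega> - g \<omega>))\<^sup>2)"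
  using integrable_norm_square_add[of f "\<lambda>\<omega>. - g \<omega>"] assms by simp

lemmas (in prob_space) integrable_norm_square_intros =
  integrable_norm_square_add integrable_norm_square_diff integrable_norm_square_scaleR

lemma borel_measurable_nth: "(\<lambda>y :: 'a::euclidean_space^'m. y $ i) \<in> borel_measurable borel"
  by (intro borel_measurable_linear bounded_linear.linear bounded_linear_vec_nth)

lemma borel_measurable_vec_nth:
  fixes f :: "'w \<Rightarrow> 'a::euclidean_space^'m"
  shows "f \<in> borel_measurable M \<Longrightarrow> (\<lambda>\<omega>. f \<omega> $ i) \<in> borel_measurable M"
  by (rule measurable_compose[OF _ borel_measurable_nth])

lemma borel_measurable_vec_lambda:
  fixes f :: "'m::finite \<Rightarrow> 'w \<Rightarrow> 'a::euclidean_space"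
  assumes "\<And>i. f i \<in> borel_measurable M"
  shows "(\<lambda>\<omega>. \<chi> i. f i \<omega>) \<in> borel_measurable M"
  unfolding borel_measurable_euclidean_space[where f="\<lambda>\<omega>. \<chi> i. f i \<omega>"]
  using assms by (auto simp: Basis_vec_def inner_axis)

lemma norm_vec_square: "(norm (v :: 'a::real_inner^'m))\<^sup>2 = (\<Sum>i\<in>UNIV. (norm (v $ i))\<^sup>2)"
  by (simp add: power2_norm_eq_inner inner_vec_def)

lemma norm_agent_mean_le_bound:
  fixes v :: "'m::finite \<Rightarrow> 'a::real_normed_vector"
  assumes "\<And>i. norm (v i) \<le> c"
  shows "norm (agent_mean v) \<le> c"
proof -
  have "norm (\<Sum>i\<in>UNIV. v i) \<le> CARD('m) * c"
    using sum_norm_le[of UNIV v "\<lambda>_. c"] assms by simp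
  then show ?thesis by (simp add: agent_mean_def field_simps)
qed

lemma agent_mean_diff: "agent_mean (\<lambda>i. v i - w i) = agent_mean v - agent_mean w"
  by (simp add: agent_mean_def sum_subtractf scaleR_diff_right)

lemma borel_measurable_lipschitz:
  fixes h :: "'a::real_normed_vector \<Rightarrow> 'b::real_normed_vector"
  assumes "\<And>y z. norm (h y - h z) \<le> K * norm (y - z)"
  shows "h \<in> borel_measurable borel"
proof -
  have "norm (h y - h z) \<le> \<bar>K\<bar> * norm (y - z)" for y z
    using assms[of y z] by (smt (verit) mult_right_mono norm_ge_zero)
  then have "\<bar>K\<bar>-lipschitz_on UNIV h"
    by (intro lipschitz_onI) (auto simp: dist_norm)
  then show ?thesis
    by (intro borel_measurable_continuous_onI lipschitz_on_continuous_on)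
qed

subsection \<open>Fresh noise\<close>

text \<open>Independence of \<open>Y\<close> from \<open>X\<close> together with the law
  \<open>S\<close> of \<open>Y\<close>, encoded as a product form of the joint law. Conditional
  moments given \<open>X\<close> thereby become inner integrals over \<open>S\<close>.\<close>

definition (in prob_space) fresh_noise :: "('a \<Rightarrow> 'b::topological_space) \<Rightarrow> 's measure \<Rightarrow> ('a \<Rightarrow> 's) \<Rightarrow> bool" where
  "fresh_noise X S Y \<longleftrightarrow> random_variable borel X \<and> random_variable S Y \<and> distr M S Y = S \<and>
     distr M borel X \<Otimes>\<^sub>M S = distr M (borel \<Otimes>\<^sub>M S) (\<lambda>\<omega>. (X \<omega>, Y \<omega>))"

text \<open>Tonelli for the product law. The computation runs with nonnegative extended integrals
  because integrability along the trajectory is itself a conclusion.\<close>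

lemma (in prob_space) fresh_noise_second_moment:
  fixes q :: "'b::euclidean_space \<Rightarrow> 's \<Rightarrow> 'c::euclidean_space" and S :: "'s measure"
  assumes fresh: "fresh_noise X S Y"
    and q [measurable]: "(\<lambda>(x, s). q x s) \<in> borel_measurable (borel \<Otimes>\<^sub>M S)"
    and int: "\<And>x. integrable S (\<lambda>s. (norm (q x s))\<^sup>2)"
    and le: "\<And>x. (\<integral>s. (norm (q x s))\<^sup>2 \<partial>S) \<le> V x"
    and V [measurable]: "V \<in> borel_measurable borel" "integrable M (\<lambda>\<omega>. V (X \<omega>))"
  shows "integrable M (\<lambda>\<omega>. (norm (q (X \<omega>) (Y \<omega>)))\<^sup>2)"
    and "expectation (\<lambda>\<omega>. (norm (q (X \<omega>) (Y \<omega>)))\<^sup>2) \<le> expectation (\<lambda>\<omega>. V (X \<omega>))"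
proof -
  have X [measurable]: "X \<in> borel_measurable M" and Y [measurable]: "Y \<in> measurable M S"
    and joint: "distr M borel X \<Otimes>\<^sub>M S = distr M (borel \<Otimes>\<^sub>M S) (\<lambda>\<omega>. (X \<omega>, Y \<omega>))"
    using fresh unfolding fresh_noise_def by auto
  interpret S: prob_space S using prob_space_distr[OF Y] fresh by (simp add: fresh_noise_def)
  have V0: "0 \<le> V x" for x by (rule order.trans[OF Bochner_Integration.integral_nonneg le]) simp
  have "(\<integral>\<^sup>+\<omega>. ennreal ((norm (q (X \<omega>) (Y \<omega>)))\<^sup>2) \<partial>M)
      = (\<integral>\<^sup>+p. ennreal ((norm (q (fst p) (snd p)))\<^sup>2) \<partial>distr M (borel \<Otimes>\<^sub>M S) (\<lambda>\<omega>. (X \<omega>, Y \<omega>)))"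
    using q by (subst nn_integral_distr) (auto simp: case_prod_beta')
  also have "\<dots> = (\<integral>\<^sup>+x. \<integral>\<^sup>+s. ennreal ((norm (q x s))\<^sup>2) \<partial>S \<partial>distr M borel X)"
    unfolding joint[symmetric] using q by (subst S.nn_integral_fst[symmetric]) (auto simp: case_prod_beta')
  also have "\<dots> \<le> (\<integral>\<^sup>+x. ennreal (V x) \<partial>distr M borel X)"
    using le int by (intro nn_integral_mono) (simp add: nn_integral_eq_integral ennreal_leI)
  also have "\<dots> = (\<integral>\<^sup>+\<omega>. ennreal (V (X \<omega>)) \<partial>M)"
    by (subst nn_integral_distr) auto
  also have "\<dots> = ennreal (expectation (\<lambda>\<omega>. V (X \<omega>)))"
    using V V0 by (intro nn_integral_eq_integral) auto
  finally have *: "(\<integral>\<^sup>+\<omega>. ennreal ((norm (q (X \<omega>) (Y \<omega>)))\<^sup>2) \<partial>M) \<le> ennreal (expectation (\<lambda>\<omega>. V (X \<omega>)))" .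
  have [measurable]: "(\<lambda>\<omega>. q (X \<omega>) (Y \<omega>)) \<in> borel_measurable M"
    using measurable_compose[OF _ q, of "\<lambda>\<omega>. (X \<omega>, Y \<omega>)" M] by simp
  show i: "integrable M (\<lambda>\<omega>. (norm (q (X \<omega>) (Y \<omega>)))\<^sup>2)"
    using * by (intro integrableI_bounded) (auto intro: le_less_trans)
  have "0 \<le> expectation (\<lambda>\<omega>. V (X \<omega>))" using V0 by (intro Bochner_Integration.integral_nonneg) simp
  with * show "expectation (\<lambda>\<omega>. (norm (q (X \<omega>) (Y \<omega>)))\<^sup>2) \<le> expectation (\<lambda>\<omega>. V (X \<omega>))"
    using i by (subst (asm) nn_integral_eq_integral) auto
qed

text \<open>By Fubini \<open>\<phi>\<close> leaves the inner integral, which then vanishes. The mean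
  is required to be zero only almost surely along the trajectory, matching how unbiased gradients
  are assumed.\<close>

lemma (in prob_space) fresh_noise_orthogonal:
  fixes q :: "'b::euclidean_space \<Rightarrow> 's \<Rightarrow> 'c::euclidean_space" and S :: "'s measure"
  assumes fresh: "fresh_noise X S Y"
    and q [measurable]: "(\<lambda>(x, s). q x s) \<in> borel_measurable (borel \<Otimes>\<^sub>M S)"
    and int: "\<And>x. integrable S (\<lambda>s. (norm (q x s))\<^sup>2)"
    and mean: "AE \<omega> in M. (\<integral>s. q (X \<omega>) s \<partial>S) = 0"
    and qq: "integrable M (\<lambda>\<omega>. (norm (q (X \<omega>) (Y \<omega>)))\<^sup>2)"
    and \<phi> [measurable]: "\<phi> \<in> borel_measurable borel" and \<phi>2: "integrable M (\<lambda>\<omega>. (norm (\<phi> (X \<omega>)))\<^sup>2)"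
  shows "expectation (\<lambda>\<omega>. \<phi> (X \<omega>) \<bullet> q (X \<omega>) (Y \<omega>)) = 0"
proof -
  have X [measurable]: "X \<in> borel_measurable M" and Y [measurable]: "Y \<in> measurable M S"
    and joint: "distr M borel X \<Otimes>\<^sub>M S = distr M (borel \<Otimes>\<^sub>M S) (\<lambda>\<omega>. (X \<omega>, Y \<omega>))"
    using fresh unfolding fresh_noise_def by auto
  interpret S: prob_space S using prob_space_distr[OF Y] fresh by (simp add: fresh_noise_def)
  interpret X: prob_space "distr M borel X" by (rule prob_space_distr) simp
  interpret P: pair_sigma_finite "distr M borel X" S ..
  have [measurable]: "(\<lambda>\<omega>. q (X \<omega>) (Y \<omega>)) \<in> borel_measurable M"
    using measurable_compose[OF _ q, of "\<lambda>\<omega>. (X \<omega>, Y \<omega>)" M] by simp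
  have q' [measurable]: "(\<lambda>p. \<phi> (fst p) \<bullet> q (fst p) (snd p)) \<in> borel_measurable (borel \<Otimes>\<^sub>M S)"
    using q by (intro borel_measurable_inner) (auto simp: case_prod_beta')
  have qx [measurable]: "q x \<in> borel_measurable S" for x
    using measurable_compose[OF measurable_Pair1' q, of x] by simp
  have "integrable M (\<lambda>\<omega>. \<phi> (X \<omega>) \<bullet> q (X \<omega>) (Y \<omega>))"
    by (intro integrable_inner \<phi>2 qq) auto
  then have I: "integrable (distr M borel X \<Otimes>\<^sub>M S) (\<lambda>p. \<phi> (fst p) \<bullet> q (fst p) (snd p))"
    unfolding joint by (subst integrable_distr_eq) auto
  have "expectation (\<lambda>\<omega>. \<phi> (X \<omega>) \<bullet> q (X \<omega>) (Y \<omega>))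
      = (\<integral>p. \<phi> (fst p) \<bullet> q (fst p) (snd p) \<partial>(distr M borel X \<Otimes>\<^sub>M S))"
    unfolding joint by (subst integral_distr) auto
  also have "\<dots> = (\<integral>x. \<integral>s. \<phi> x \<bullet> q x s \<partial>S \<partial>distr M borel X)"
    using P.integral_fst'[OF I] by simp
  also have "\<dots> = (\<integral>x. \<phi> x \<bullet> (\<integral>s. q x s \<partial>S) \<partial>distr M borel X)"
    by (intro Bochner_Integration.integral_cong refl integral_inner_right)
      (auto intro!: S.integrable_of_norm_square int)
  also have "\<dots> = expectation (\<lambda>\<omega>. \<phi> (X \<omega>) \<bullet> (\<integral>s. q (X \<omega>) s \<partial>S))"
    by (intro integral_distr borel_measurable_inner S.borel_measurable_lebesgue_integral) auto
  also have "\<dots> = expectation (\<lambda>\<omega>. 0)"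
    using mean by (intro integral_cong_AE borel_measurable_inner) (auto elim!: eventually_mono intro!: measurable_compose[OF X S.borel_measurable_lebesgue_integral])
  finally show ?thesis by simp
qed

text \<open>Squared norms and inner products of stacked vectors are sums over the agents, so each
  claim reduces to the noise of one agent.\<close>

lemma (in prob_space)
  fixes q :: "'m::finite \<Rightarrow> 'b::euclidean_space \<Rightarrow> 's \<Rightarrow> 'c::euclidean_space" and S :: "'m \<Rightarrow> 's measure"
  assumes fresh: "\<And>i. fresh_noise X (S i) (Y i)"
    and q: "\<And>i. (\<lambda>(x, s). q i x s) \<in> borel_measurable (borel \<Otimes>\<^sub>M S i)"
    and int: "\<And>i x. integrable (S i) (\<lambda>s. (norm (q i x s))\<^sup>2)"
    and le: "\<And>i x. (\<integral>s. (norm (q i x s))\<^sup>2 \<partial>S i) \<le> V i x"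
    and V: "\<And>i. V i \<in> borel_measurable borel" "\<And>i. integrable M (\<lambda>\<omega>. V i (X \<omega>))"
  shows stacked_noise_measurable: "random_variable borel (\<lambda>\<omega>. \<chi> i. q i (X \<omega>) (Y i \<omega>))"
    and stacked_noise_square_integrable: "integrable M (\<lambda>\<omega>. (norm (\<chi> i. q i (X \<omega>) (Y i \<omega>)))\<^sup>2)"
    and stacked_noise_second_moment: "expectation (\<lambda>\<omega>. (norm (\<chi> i. q i (X \<omega>) (Y i \<omega>)))\<^sup>2)
      \<le> (\<Sum>i\<in>UNIV. expectation (\<lambda>\<omega>. V i (X \<omega>)))"
    and stacked_noise_orthogonal: "(\<And>i. AE \<omega> in M. (\<integral>s. q i (X \<omega>) s \<partial>S i) = 0) \<Longrightarrow>
      \<phi> \<in> borel_measurable borel \<Longrightarrow> integrable M (\<lambda>\<omega>. (norm (\<phi> (X \<omega>)))\<^sup>2) \<Longrightarrow>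
      expectation (\<lambda>\<omega>. \<phi> (X \<omega>) \<bullet> (\<chi> i. q i (X \<omega>) (Y i \<omega>))) = 0"
proof -
  have X: "X \<in> borel_measurable M" and Y: "Y i \<in> measurable M (S i)" for i
    using fresh unfolding fresh_noise_def by auto
  have m: "(\<lambda>\<omega>. q i (X \<omega>) (Y i \<omega>)) \<in> borel_measurable M" for i
    using measurable_compose[OF measurable_Pair[OF X Y] q] by simp
  show "random_variable borel (\<lambda>\<omega>. \<chi> i. q i (X \<omega>) (Y i \<omega>))"
    by (intro borel_measurable_vec_lambda m)
  note moment = fresh_noise_second_moment[OF fresh q int le V]
  show "integrable M (\<lambda>\<omega>. (norm (\<chi> i. q i (X \<omega>) (Y i \<omega>)))\<^sup>2)"
    unfolding norm_vec_square using moment(1) by simp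
  show "expectation (\<lambda>\<omega>. (norm (\<chi> i. q i (X \<omega>) (Y i \<omega>)))\<^sup>2) \<le> (\<Sum>i\<in>UNIV. expectation (\<lambda>\<omega>. V i (X \<omega>)))"
    unfolding norm_vec_square using moment by (simp add: sum_mono)
  assume mean: "\<And>i. AE \<omega> in M. (\<integral>s. q i (X \<omega>) s \<partial>S i) = 0"
    and \<phi>: "\<phi> \<in> borel_measurable borel" "integrable M (\<lambda>\<omega>. (norm (\<phi> (X \<omega>)))\<^sup>2)"
  have \<phi>_nth: "(\<lambda>x. \<phi> x $ i) \<in> borel_measurable borel" "(\<lambda>\<omega>. \<phi> (X \<omega>) $ i) \<in> borel_measurable M" for i
    using \<phi>(1) X by (auto intro!: borel_measurable_vec_nth)
  have \<phi>2: "integrable M (\<lambda>\<omega>. (norm (\<phi> (X \<omega>) $ i))\<^sup>2)" for i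
    using \<phi>_nth(2)[of i]
    by (intro Bochner_Integration.integrable_bound[OF \<phi>(2)])
      (auto intro!: AE_I2 power_mono Finite_Cartesian_Product.norm_nth_le)
  have "expectation (\<lambda>\<omega>. \<phi> (X \<omega>) \<bullet> (\<chi> i. q i (X \<omega>) (Y i \<omega>)))
      = (\<Sum>i\<in>UNIV. expectation (\<lambda>\<omega>. \<phi> (X \<omega>) $ i \<bullet> q i (X \<omega>) (Y i \<omega>)))"
    unfolding inner_vec_def vec_lambda_beta
    by (intro Bochner_Integration.integral_sum integrable_inner \<phi>_nth \<phi>2 m moment)
  also have "\<dots> = 0"
    by (intro sum.neutral ballI fresh_noise_orthogonal[OF fresh q int mean moment(1) \<phi>_nth(1) \<phi>2])
  finally show "expectation (\<lambda>\<omega>. \<phi> (X \<omega>) \<bullet> (\<chi> i. q i (X \<omega>) (Y i \<omega>))) = 0" .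
qed

text \<open>By induction the state at time \<open>k\<close> is a measurable function
  \<open>h\<close> of the inputs before \<open>k\<close>, and these are independent of the input at
  \<open>k\<close>. Pushing the product law of past and present through \<open>h\<close> and
  \<open>p\<close> gives the claim; \<open>p\<close> selects one agent's sample or quantization
  seed.\<close>

lemma (in prob_space) fresh_noise_of_recursion:
  fixes X :: "nat \<Rightarrow> 'a \<Rightarrow> 'b::topological_space" and U :: "nat \<Rightarrow> 'a \<Rightarrow> 'u" and N :: "'u measure"
    and S :: "'s measure"
  assumes ind: "indep_vars (\<lambda>_. N) U UNIV"
    and init: "\<And>\<omega>. \<omega> \<in> space M \<Longrightarrow> X 0 \<omega> = c"
    and step: "\<And>k \<omega>. \<omega> \<in> space M \<Longrightarrow> X (Suc k) \<omega> = \<Phi> k (X k \<omega>) (U k \<omega>)"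
    and \<Phi>: "\<And>k. (\<lambda>(x, u). \<Phi> k x u) \<in> borel_measurable (borel \<Otimes>\<^sub>M N)"
    and p: "p \<in> measurable N S" and law: "distr M S (\<lambda>\<omega>. p (U k \<omega>)) = S"
  shows "fresh_noise (X k) S (\<lambda>\<omega>. p (U k \<omega>))"
proof -
  have U: "random_variable N (U k)" for k
    using ind by (auto simp: indep_vars_def)
  have "\<exists>h \<in> borel_measurable (PiM {..<k} (\<lambda>_. N)). \<forall>\<omega>\<in>space M. X k \<omega> = h (\<lambda>j\<in>{..<k}. U j \<omega>)" for k
  proof (induction k)
    case 0
    show ?case by (intro bexI[of _ "\<lambda>_. c"]) (auto simp: init)
  next
    case (Suc k)
    then obtain h where h [measurable]: "h \<in> borel_measurable (PiM {..<k} (\<lambda>_. N))"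
      and X: "\<forall>\<omega>\<in>space M. X k \<omega> = h (\<lambda>j\<in>{..<k}. U j \<omega>)" by blast
    have "(\<lambda>w. h (restrict w {..<k})) \<in> borel_measurable (PiM {..<Suc k} (\<lambda>_. N))"
      by (rule measurable_compose[OF measurable_restrict_subset h]) auto
    moreover have "(\<lambda>w. w k) \<in> measurable (PiM {..<Suc k} (\<lambda>_. N)) N"
      by (rule measurable_component_singleton) simp
    ultimately have "(\<lambda>w. (\<lambda>(x, u). \<Phi> k x u) (h (restrict w {..<k}), w k)) \<in> borel_measurable (PiM {..<Suc k} (\<lambda>_. N))"
      by (intro measurable_compose[OF _ \<Phi>] measurable_Pair)
    moreover have "restrict (\<lambda>j\<in>{..<Suc k}. U j \<omega>) {..<k} = (\<lambda>j\<in>{..<k}. U j \<omega>)" for \<omega>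
      by (auto simp: restrict_def fun_eq_iff)
    ultimately show ?case
      by (intro bexI[of _ "\<lambda>w. (\<lambda>(x, u). \<Phi> k x u) (h (restrict w {..<k}), w k)"]) (auto simp: step X cong: restrict_cong)
  qed
  then obtain h where h: "h \<in> borel_measurable (PiM {..<k} (\<lambda>_. N))"
    and X: "\<And>\<omega>. \<omega> \<in> space M \<Longrightarrow> X k \<omega> = h (\<lambda>j\<in>{..<k}. U j \<omega>)" by blast
  let ?P = "PiM {..<k} (\<lambda>_. N)" and ?F = "PiM {k} (\<lambda>_. N)"
  let ?past = "\<lambda>\<omega>. \<lambda>j\<in>{..<k}. U j \<omega>" and ?now = "\<lambda>\<omega>. \<lambda>j\<in>{k}. U j \<omega>"
  let ?q = "\<lambda>w. p (w k)"
  have "indep_var ?P ?past ?F ?now"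
    by (rule indep_var_restrict[OF ind]) auto
  then have past: "random_variable ?P ?past" and now: "random_variable ?F ?now"
    and joint: "distr M ?P ?past \<Otimes>\<^sub>M distr M ?F ?now = distr M (?P \<Otimes>\<^sub>M ?F) (\<lambda>\<omega>. (?past \<omega>, ?now \<omega>))"
    unfolding indep_var_distribution_eq by auto
  have q: "?q \<in> measurable ?F S"
    using measurable_compose[OF measurable_component_singleton[of k "{k}" "\<lambda>_. N"] p] by simp
  have Xm: "random_variable borel (X k)"
    using measurable_compose[OF past h] by (subst measurable_cong[OF X])
  have Y: "random_variable S (\<lambda>\<omega>. p (U k \<omega>))"
    by (rule measurable_compose[OF U p])
  have dX: "distr M borel (X k) = distr (distr M ?P ?past) borel h"
    by (subst distr_distr[OF h past]) (auto intro!: distr_cong simp: X)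
  have dY: "S = distr (distr M ?F ?now) S ?q"
    by (subst distr_distr[OF q now]) (simp add: o_def law)
  interpret S: prob_space S using prob_space_distr[OF Y] law by simp
  \<comment> \<open>Sigma-finiteness of the second factor is what lets the push-forward of a product
    be computed factor by factor.\<close>
  have "sigma_finite_measure (distr (distr M ?F ?now) S ?q)"
    unfolding dY[symmetric] by (rule S.sigma_finite_measure_axioms)
  then have "distr (distr M ?P ?past) borel h \<Otimes>\<^sub>M distr (distr M ?F ?now) S ?q
      = distr (distr M ?P ?past \<Otimes>\<^sub>M distr M ?F ?now) (borel \<Otimes>\<^sub>M S) (\<lambda>(x, y). (h x, ?q y))"
    using h q by (intro pair_measure_distr) auto
  also have "\<dots> = distr M (borel \<Otimes>\<^sub>M S) ((\<lambda>(x, y). (h x, ?q y)) \<circ> (\<lambda>\<omega>. (?past \<omega>, ?now \<omega>)))"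
    unfolding joint using h q past now
    by (intro distr_distr measurable_Pair) (auto simp: case_prod_beta' intro!: measurable_Pair measurable_compose[OF measurable_fst] measurable_compose[OF measurable_snd])
  also have "\<dots> = distr M (borel \<Otimes>\<^sub>M S) (\<lambda>\<omega>. (X k \<omega>, p (U k \<omega>)))"
    by (intro distr_cong refl) (simp add: X)
  finally show ?thesis
    unfolding fresh_noise_def using Xm Y law dX dY by simp
qed

subsection \<open>Consensus with conditionally centred noise\<close>

text \<open>All probabilistic input is condensed into moments and orthogonality to functions of the
  state. The clauses on \<open>err\<close> presuppose a square integrable state, since the quantizer
  variance depends on it and this integrability is only obtained by induction over the steps; the
  clauses on \<open>noise\<close> are uniform.\<close>

locale noisy_consensus = prob_space M for M :: "'w measure" +
  fixes W :: "real^'m^'m" and X err noise :: "nat \<Rightarrow> 'w \<Rightarrow> 'a::euclidean_space^'m"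
    and H :: "'a^'m \<Rightarrow> 'a^'m" and \<epsilon> \<alpha> :: "nat \<Rightarrow> real" and \<beta> s C :: real
  assumes X_measurable [measurable]: "\<And>k. random_variable borel (X k)"
    and err_measurable [measurable]: "\<And>k. random_variable borel (err k)"
    and noise_measurable [measurable]: "\<And>k. random_variable borel (noise k)"
    and H_measurable [measurable]: "H \<in> borel_measurable borel"
    and W_symmetric: "\<And>i j. W $ i $ j = W $ j $ i"
    and \<epsilon>_pos: "\<And>k. \<epsilon> k > 0" and \<alpha>_pos: "\<And>k. \<alpha> k > 0"
    and init: "\<And>\<omega>. \<omega> \<in> space M \<Longrightarrow> X 0 \<omega> = 0"
    and step: "\<And>k \<omega>. \<omega> \<in> space M \<Longrightarrow> X (Suc k) \<omega> =
      X k \<omega> - \<epsilon> k *\<^sub>R diffusion W (X k \<omega> + err k \<omega>) - (\<epsilon> k * \<alpha> k) *\<^sub>R (H (X k \<omega>) + noise k \<omega>)"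
    and H_bound: "\<And>y. norm (H y) \<le> C"
    and \<beta>_nonneg: "\<beta> \<ge> 0"
    and err_square_integrable: "\<And>k. integrable M (\<lambda>\<omega>. (norm (X k \<omega>))\<^sup>2) \<Longrightarrow> integrable M (\<lambda>\<omega>. (norm (err k \<omega>))\<^sup>2)"
    and err_moment: "\<And>k. integrable M (\<lambda>\<omega>. (norm (X k \<omega>))\<^sup>2) \<Longrightarrow>
      expectation (\<lambda>\<omega>. (norm (err k \<omega>))\<^sup>2) \<le> \<beta> * expectation (\<lambda>\<omega>. (norm (X k \<omega>))\<^sup>2)"
    and noise_square_integrable: "\<And>k. integrable M (\<lambda>\<omega>. (norm (noise k \<omega>))\<^sup>2)"
    and noise_moment: "\<And>k. expectation (\<lambda>\<omega>. (norm (noise k \<omega>))\<^sup>2) \<le> s"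
    and err_orthogonal: "\<And>k \<phi>. integrable M (\<lambda>\<omega>. (norm (X k \<omega>))\<^sup>2) \<Longrightarrow> \<phi> \<in> borel_measurable borel \<Longrightarrow>
      integrable M (\<lambda>\<omega>. (norm (\<phi> (X k \<omega>)))\<^sup>2) \<Longrightarrow> expectation (\<lambda>\<omega>. \<phi> (X k \<omega>) \<bullet> err k \<omega>) = 0"
    and noise_orthogonal: "\<And>k \<phi>. \<phi> \<in> borel_measurable borel \<Longrightarrow>
      integrable M (\<lambda>\<omega>. (norm (\<phi> (X k \<omega>)))\<^sup>2) \<Longrightarrow> expectation (\<lambda>\<omega>. \<phi> (X k \<omega>) \<bullet> noise k \<omega>) = 0"
begin

lemmas linear_measurable [measurable] =
  borel_measurable_linear[OF linear_diffusion] borel_measurable_linear[OF linear_deviation]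
  borel_measurable_linear[OF linear_agent_mean]

lemma H_square_integrable: "integrable M (\<lambda>\<omega>. (norm (H (X k \<omega>)))\<^sup>2)"
  by (rule integrable_norm_square_bounded[OF _ H_bound]) simp

lemma X_square_integrable: "integrable M (\<lambda>\<omega>. (norm (X k \<omega>))\<^sup>2)"
proof (induction k)
  case 0
  have "integrable M (\<lambda>\<omega>. (norm (X 0 \<omega>))\<^sup>2) \<longleftrightarrow> integrable M (\<lambda>\<omega>. 0 :: real)"
    by (intro Bochner_Integration.integrable_cong refl) (simp add: init)
  then show ?case by simp
next
  case (Suc k)
  note I = Suc err_square_integrable[OF Suc] H_square_integrable noise_square_integrable
  have "integrable M (\<lambda>\<omega>. (norm (X k \<omega> - \<epsilon> k *\<^sub>R diffusion W (X k \<omega> + err k \<omega>)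
      - (\<epsilon> k * \<alpha> k) *\<^sub>R (H (X k \<omega>) + noise k \<omega>)))\<^sup>2)"
    by (intro integrable_norm_square_intros integrable_norm_square_linear[OF linear_diffusion] I) measurable
  also have "?this \<longleftrightarrow> ?case"
    by (intro Bochner_Integration.integrable_cong refl) (simp add: step)
  finally show ?case .
qed

lemmas square_integrable = X_square_integrable err_square_integrable[OF X_square_integrable]
  H_square_integrable noise_square_integrable

lemmas square_integrable_intros = square_integrable integrable_norm_square_intros
  integrable_norm_square_linear[OF linear_diffusion] integrable_norm_square_linear[OF linear_deviation]
  integrable_norm_square_linear[OF linear_agent_mean]

text \<open>The adjoint moves \<open>A\<close> onto the test function, and \<open>adjoint A\<close>
  after \<open>\<phi>\<close> is again an admissible function of the state.\<close>

lemma err_linear_orthogonal: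
  fixes A :: "'a^'m \<Rightarrow> 'b::euclidean_space"
  assumes A: "linear A" and [measurable]: "\<phi> \<in> borel_measurable borel"
    and \<phi>: "integrable M (\<lambda>\<omega>. (norm (\<phi> (X k \<omega>)))\<^sup>2)"
  shows "expectation (\<lambda>\<omega>. \<phi> (X k \<omega>) \<bullet> A (err k \<omega>)) = 0"
proof -
  note [measurable] = borel_measurable_linear[OF adjoint_linear[OF A]]
  have "expectation (\<lambda>\<omega>. adjoint A (\<phi> (X k \<omega>)) \<bullet> err k \<omega>) = 0"
    by (rule err_orthogonal[OF X_square_integrable])
      (use integrable_norm_square_linear[OF adjoint_linear[OF A] _ \<phi>] in auto)
  then show ?thesis
    by (simp add: adjoint_clauses[OF A])
qed

lemma noise_linear_orthogonal:
  fixes A :: "'a^'m \<Rightarrow> 'b::euclidean_space"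
  assumes A: "linear A" and [measurable]: "\<phi> \<in> borel_measurable borel"
    and \<phi>: "integrable M (\<lambda>\<omega>. (norm (\<phi> (X k \<omega>)))\<^sup>2)"
  shows "expectation (\<lambda>\<omega>. \<phi> (X k \<omega>) \<bullet> A (noise k \<omega>)) = 0"
proof -
  note [measurable] = borel_measurable_linear[OF adjoint_linear[OF A]]
  have "expectation (\<lambda>\<omega>. adjoint A (\<phi> (X k \<omega>)) \<bullet> noise k \<omega>) = 0"
    by (rule noise_orthogonal)
      (use integrable_norm_square_linear[OF adjoint_linear[OF A] _ \<phi>] in auto)
  then show ?thesis
    by (simp add: adjoint_clauses[OF A])
qed

lemma agent_mean_step:
  assumes "\<omega> \<in> space M"
  shows "agent_mean (($) (X (Suc k) \<omega>)) =
    agent_mean (($) (X k \<omega>)) + (- (\<epsilon> k * \<alpha> k)) *\<^sub>R agent_mean (($) (H (X k \<omega>) + noise k \<omega>))"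
  unfolding step[OF assms] linear_diff[OF linear_agent_mean] linear_cmul[OF linear_agent_mean]
    agent_mean_diffusion[OF W_symmetric] by simp

definition drift_bound where "drift_bound = 2 * C\<^sup>2 + 2 * s"

lemma drift_moment: "expectation (\<lambda>\<omega>. (norm (agent_mean (($) (H (X k \<omega>) + noise k \<omega>))))\<^sup>2) \<le> drift_bound"
proof -
  have C: "(norm (H y))\<^sup>2 \<le> C\<^sup>2" for y using H_bound[of y] by (simp add: power_mono)
  have "(norm (agent_mean (($) (H y + n))))\<^sup>2 \<le> 2 * C\<^sup>2 + 2 * (norm n)\<^sup>2" for y n
    using norm_agent_mean_le[of "H y + n"] norm_add_square_le[of "H y" n] C[of y] by linarith
  then have "expectation (\<lambda>\<omega>. (norm (agent_mean (($) (H (X k \<omega>) + noise k \<omega>))))\<^sup>2)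
      \<le> expectation (\<lambda>\<omega>. 2 * C\<^sup>2 + 2 * (norm (noise k \<omega>))\<^sup>2)"
    by (intro integral_mono square_integrable_intros Bochner_Integration.integrable_add
          integrable_mult_right integrable_const) auto
  also have "\<dots> = 2 * C\<^sup>2 + 2 * expectation (\<lambda>\<omega>. (norm (noise k \<omega>))\<^sup>2)"
    by (simp add: noise_square_integrable prob_space)
  finally show ?thesis using noise_moment[of k] by (simp add: drift_bound_def)
qed

text \<open>The mean moves by \<open>\<epsilon> k * \<alpha> k\<close> times a vector of bounded
  second moment, so its root mean square grows at most linearly in the accumulated step. This is
  Minkowski's inequality, carried out by weighted convexity.\<close>

lemma agent_mean_moment:
  "expectation (\<lambda>\<omega>. (norm (agent_mean (($) (X k \<omega>))))\<^sup>2) \<le> drift_bound * (\<Sum>j<k. \<epsilon> j * \<alpha> j)\<^sup>2"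
proof (induction k)
  case 0
  have "expectation (\<lambda>\<omega>. (norm (agent_mean (($) (X 0 \<omega>))))\<^sup>2) = expectation (\<lambda>\<omega>. 0)"
    by (intro Bochner_Integration.integral_cong refl) (simp add: init linear_0[OF linear_agent_mean])
  then show ?case by simp
next
  case (Suc k)
  define T where "T = (\<Sum>j<k. \<epsilon> j * \<alpha> j)"
  define c where "c = \<epsilon> k * \<alpha> k"
  let ?p = "\<lambda>\<omega>. agent_mean (($) (X k \<omega>))" and ?q = "\<lambda>\<omega>. agent_mean (($) (H (X k \<omega>) + noise k \<omega>))"
  have c: "c > 0" using \<epsilon>_pos \<alpha>_pos by (simp add: c_def)
  have T: "T \<ge> 0" unfolding T_def by (intro sum_nonneg) (simp add: \<epsilon>_pos \<alpha>_pos less_imp_le)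
  have I: "integrable M (\<lambda>\<omega>. (norm (?p \<omega>))\<^sup>2)" "integrable M (\<lambda>\<omega>. (norm (?q \<omega>))\<^sup>2)"
    by (intro square_integrable_intros; measurable)+
  have le: "(norm (agent_mean (($) (X (Suc k) \<omega>))))\<^sup>2 \<le> (T + c) * ((norm (?p \<omega>))\<^sup>2 / T + c * (norm (?q \<omega>))\<^sup>2)"
    if "\<omega> \<in> space M" for \<omega>
  \<comment> \<open>At the start \<open>T\<close> is 0 and the quotient by \<open>T\<close> has the
    default value 0; the bound still holds because the mean starts at 0.\<close>
  proof (cases "k = 0")
    case True
    then have "?p \<omega> = 0" using init[OF that] by (simp add: linear_0[OF linear_agent_mean])
    then show ?thesis using agent_mean_step[OF that, of k] True abs_of_pos[OF c]
      by (simp add: c_def T_def power2_eq_square mult.assoc mult.left_commute)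
  next
    case False
    then have "T > 0" unfolding T_def by (intro sum_pos) (auto simp: \<epsilon>_pos \<alpha>_pos)
    then show ?thesis
      using norm_add_scaleR_square_le[of T c "?p \<omega>" "- ?q \<omega>"] c agent_mean_step[OF that, of k]
      by (simp add: c_def)
  qed
  have "expectation (\<lambda>\<omega>. (norm (agent_mean (($) (X (Suc k) \<omega>))))\<^sup>2)
      \<le> expectation (\<lambda>\<omega>. (T + c) * ((norm (?p \<omega>))\<^sup>2 / T + c * (norm (?q \<omega>))\<^sup>2))"
    using I by (intro integral_mono le square_integrable_intros) auto
  also have "\<dots> = (T + c) * (expectation (\<lambda>\<omega>. (norm (?p \<omega>))\<^sup>2) / T + c * expectation (\<lambda>\<omega>. (norm (?q \<omega>))\<^sup>2))"
    using I by simp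
  also have "\<dots> \<le> (T + c) * (drift_bound * T\<^sup>2 / T + c * drift_bound)"
    using T c Suc drift_moment[of k] unfolding T_def[symmetric]
    by (intro mult_left_mono add_mono divide_right_mono) auto
  also have "\<dots> = drift_bound * (T + c)\<^sup>2"
    by (cases "T = 0") (simp_all add: power2_eq_square algebra_simps)
  finally show ?case by (simp add: T_def c_def)
qed

text \<open>The new deviation is a function of the current state minus fresh centred noise.
  Orthogonality removes the cross term, so the noise contributes only at order
  \<open>(\<epsilon> k)\<^sup>2\<close>.\<close>

lemma consensus_recursion:
  assumes "\<rho> > 0" and gap: "\<And>y :: 'a^'m. \<rho> * (norm (deviation y))\<^sup>2 \<le> deviation y \<bullet> diffusion W y"
    and B: "B \<ge> 0" "\<And>y :: 'a^'m. (norm (diffusion W y))\<^sup>2 \<le> B * (norm y)\<^sup>2"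
  defines "u \<equiv> \<lambda>k. expectation (\<lambda>\<omega>. (norm (deviation (X k \<omega>)))\<^sup>2)"
  shows "u (Suc k) \<le> (1 - \<rho> * \<epsilon> k + 2 * B * (\<epsilon> k)\<^sup>2) * u k + (\<epsilon> k / \<rho> + 2 * (\<epsilon> k)\<^sup>2) * ((\<alpha> k)\<^sup>2 * C\<^sup>2)
    + (\<epsilon> k)\<^sup>2 * (2 * B * \<beta> * (u k + CARD('m) * (drift_bound * (\<Sum>j<k. \<epsilon> j * \<alpha> j)\<^sup>2)) + 2 * (\<alpha> k)\<^sup>2 * s)"
proof -
  \<comment> \<open>\<open>a\<close> is the step without noise, to which
    \<open>damped_step_norm\<close> applies; \<open>b\<close> holds the quantization error, which
    enters only through diffusion, and the gradient noise.\<close>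
  define a where "a y = deviation y - \<epsilon> k *\<^sub>R diffusion W y - (\<epsilon> k * \<alpha> k) *\<^sub>R deviation (H y)" for y
  define b where "b \<omega> = diffusion W (err k \<omega>) + \<alpha> k *\<^sub>R deviation (noise k \<omega>)" for \<omega>
  have [measurable]: "a \<in> borel_measurable borel" "random_variable borel b"
    unfolding a_def b_def by measurable
  have a2: "integrable M (\<lambda>\<omega>. (norm (a (X k \<omega>)))\<^sup>2)"
    unfolding a_def by (intro square_integrable_intros; measurable)
  have b2: "integrable M (\<lambda>\<omega>. (norm (b \<omega>))\<^sup>2)"
    unfolding b_def by (intro square_integrable_intros; measurable)
  have ab: "integrable M (\<lambda>\<omega>. a (X k \<omega>) \<bullet> b \<omega>)"
    by (intro integrable_inner a2 b2) measurable
  have ab1: "integrable M (\<lambda>\<omega>. a (X k \<omega>) \<bullet> diffusion W (err k \<omega>))"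
      "integrable M (\<lambda>\<omega>. a (X k \<omega>) \<bullet> deviation (noise k \<omega>))"
    by (intro integrable_inner a2 square_integrable_intros; measurable)+
  have "expectation (\<lambda>\<omega>. a (X k \<omega>) \<bullet> b \<omega>) = expectation (\<lambda>\<omega>. a (X k \<omega>) \<bullet> diffusion W (err k \<omega>))
      + \<alpha> k * expectation (\<lambda>\<omega>. a (X k \<omega>) \<bullet> deviation (noise k \<omega>))"
    unfolding b_def inner_add_right inner_scaleR_right using ab1 by simp
  also have "\<dots> = 0"
    using err_linear_orthogonal[OF linear_diffusion _ a2] noise_linear_orthogonal[OF linear_deviation _ a2] by simp
  finally have orth: "expectation (\<lambda>\<omega>. a (X k \<omega>) \<bullet> b \<omega>) = 0" .
  have split: "deviation (X (Suc k) \<omega>) = a (X k \<omega>) - \<epsilon> k *\<^sub>R b \<omega>" if "\<omega> \<in> space M" for \<omega>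
    unfolding step[OF that] a_def b_def
    by (simp add: linear_diff[OF linear_deviation] linear_add[OF linear_deviation] linear_cmul[OF linear_deviation]
        deviation_diffusion[OF W_symmetric] linear_add[OF linear_diffusion] algebra_simps)
  have "u (Suc k) = expectation (\<lambda>\<omega>. (norm (a (X k \<omega>)))\<^sup>2 - 2 * \<epsilon> k * (a (X k \<omega>) \<bullet> b \<omega>) + (\<epsilon> k)\<^sup>2 * (norm (b \<omega>))\<^sup>2)"
    unfolding u_def
    by (intro Bochner_Integration.integral_cong refl)
      (simp only: split power2_norm_eq_inner, simp add: inner_diff inner_commute power2_eq_square algebra_simps)
  also have "\<dots> = expectation (\<lambda>\<omega>. (norm (a (X k \<omega>)))\<^sup>2) + (\<epsilon> k)\<^sup>2 * expectation (\<lambda>\<omega>. (norm (b \<omega>))\<^sup>2)"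
    using a2 b2 ab orth by simp
  finally have u_Suc: "u (Suc k) = expectation (\<lambda>\<omega>. (norm (a (X k \<omega>)))\<^sup>2) + (\<epsilon> k)\<^sup>2 * expectation (\<lambda>\<omega>. (norm (b \<omega>))\<^sup>2)" .
  have y2: "integrable M (\<lambda>\<omega>. (norm (deviation (X k \<omega>)))\<^sup>2)"
    by (intro square_integrable_intros; measurable)
  have "expectation (\<lambda>\<omega>. (norm (a (X k \<omega>)))\<^sup>2)
      \<le> expectation (\<lambda>\<omega>. (1 - \<rho> * \<epsilon> k + 2 * B * (\<epsilon> k)\<^sup>2) * (norm (deviation (X k \<omega>)))\<^sup>2
         + (\<epsilon> k / \<rho> + 2 * (\<epsilon> k)\<^sup>2) * ((\<alpha> k)\<^sup>2 * C\<^sup>2))"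
  proof (intro integral_mono a2 Bochner_Integration.integrable_add integrable_mult_right y2 integrable_const)
    fix \<omega>
    \<comment> \<open>Diffusion does not see the mean, so its bound may be stated with the deviation
      in place of the full state.\<close>
    have dB: "(norm (diffusion W (X k \<omega>)))\<^sup>2 \<le> B * (norm (deviation (X k \<omega>)))\<^sup>2"
      using B(2)[of "deviation (X k \<omega>)"] by (simp add: diffusion_deviation)
    have "(norm (deviation (H (X k \<omega>))))\<^sup>2 \<le> C\<^sup>2"
      using norm_deviation_le power_mono[OF H_bound norm_ge_zero] by (rule order.trans)
    then have "(\<epsilon> k / \<rho> + 2 * (\<epsilon> k)\<^sup>2) * ((\<alpha> k)\<^sup>2 * (norm (deviation (H (X k \<omega>))))\<^sup>2)
        \<le> (\<epsilon> k / \<rho> + 2 * (\<epsilon> k)\<^sup>2) * ((\<alpha> k)\<^sup>2 * C\<^sup>2)"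
      using \<epsilon>_pos[of k] \<open>\<rho> > 0\<close> by (intro mult_left_mono) auto
    with damped_step_norm[OF \<open>\<rho> > 0\<close> less_imp_le[OF \<epsilon>_pos] gap dB, of k "\<alpha> k" "deviation (H (X k \<omega>))"]
    show "(norm (a (X k \<omega>)))\<^sup>2 \<le> (1 - \<rho> * \<epsilon> k + 2 * B * (\<epsilon> k)\<^sup>2) * (norm (deviation (X k \<omega>)))\<^sup>2
         + (\<epsilon> k / \<rho> + 2 * (\<epsilon> k)\<^sup>2) * ((\<alpha> k)\<^sup>2 * C\<^sup>2)"
      unfolding a_def by linarith
  qed
  also have "\<dots> = (1 - \<rho> * \<epsilon> k + 2 * B * (\<epsilon> k)\<^sup>2) * u k + (\<epsilon> k / \<rho> + 2 * (\<epsilon> k)\<^sup>2) * ((\<alpha> k)\<^sup>2 * C\<^sup>2)"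
    using y2 by (simp add: u_def prob_space)
  finally have A: "expectation (\<lambda>\<omega>. (norm (a (X k \<omega>)))\<^sup>2) \<le> \<dots>" .
  have m2: "integrable M (\<lambda>\<omega>. (norm (agent_mean (($) (X k \<omega>))))\<^sup>2)"
    by (intro square_integrable_intros; measurable)
  have "expectation (\<lambda>\<omega>. (norm (X k \<omega>))\<^sup>2) = u k + CARD('m) * expectation (\<lambda>\<omega>. (norm (agent_mean (($) (X k \<omega>))))\<^sup>2)"
    unfolding u_def norm_deviation[of "X k _"] using y2 m2 by simp
  also have "\<dots> \<le> u k + CARD('m) * (drift_bound * (\<Sum>j<k. \<epsilon> j * \<alpha> j)\<^sup>2)"
    by (intro add_left_mono mult_left_mono agent_mean_moment) simp
  finally have X2: "expectation (\<lambda>\<omega>. (norm (X k \<omega>))\<^sup>2) \<le> \<dots>" .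
  have "expectation (\<lambda>\<omega>. (norm (b \<omega>))\<^sup>2)
      \<le> expectation (\<lambda>\<omega>. 2 * B * (norm (err k \<omega>))\<^sup>2 + 2 * (\<alpha> k)\<^sup>2 * (norm (noise k \<omega>))\<^sup>2)"
  proof (intro integral_mono b2 Bochner_Integration.integrable_add integrable_mult_right square_integrable)
    fix \<omega>
    have "(norm (b \<omega>))\<^sup>2 \<le> 2 * (norm (diffusion W (err k \<omega>)))\<^sup>2 + 2 * ((\<alpha> k)\<^sup>2 * (norm (deviation (noise k \<omega>)))\<^sup>2)"
      unfolding b_def using norm_add_square_le by (rule order.trans) (simp add: power_mult_distrib)
    also have "\<dots> \<le> 2 * (B * (norm (err k \<omega>))\<^sup>2) + 2 * ((\<alpha> k)\<^sup>2 * (norm (noise k \<omega>))\<^sup>2)"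
      by (intro add_mono mult_left_mono B norm_deviation_le) auto
    finally show "(norm (b \<omega>))\<^sup>2 \<le> 2 * B * (norm (err k \<omega>))\<^sup>2 + 2 * (\<alpha> k)\<^sup>2 * (norm (noise k \<omega>))\<^sup>2" by simp
  qed
  also have "\<dots> = 2 * B * expectation (\<lambda>\<omega>. (norm (err k \<omega>))\<^sup>2) + 2 * (\<alpha> k)\<^sup>2 * expectation (\<lambda>\<omega>. (norm (noise k \<omega>))\<^sup>2)"
    by (simp add: square_integrable)
  also have "\<dots> \<le> 2 * B * (\<beta> * (u k + CARD('m) * (drift_bound * (\<Sum>j<k. \<epsilon> j * \<alpha> j)\<^sup>2))) + 2 * (\<alpha> k)\<^sup>2 * s"
    using B(1) order.trans[OF err_moment[OF X_square_integrable] mult_left_mono[OF X2 \<beta>_nonneg]] noise_moment[of k]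
    by (intro add_mono mult_left_mono) auto
  finally have "(\<epsilon> k)\<^sup>2 * expectation (\<lambda>\<omega>. (norm (b \<omega>))\<^sup>2)
    \<le> (\<epsilon> k)\<^sup>2 * (2 * B * \<beta> * (u k + CARD('m) * (drift_bound * (\<Sum>j<k. \<epsilon> j * \<alpha> j)\<^sup>2)) + 2 * (\<alpha> k)\<^sup>2 * s)"
    by (intro mult_left_mono) (simp_all only: mult.assoc zero_le_power2)
  with A show ?thesis unfolding u_Suc by linarith
qed

text \<open>The decrease is governed by the inner product of the gradient at the mean with the mean
  of the local gradients. Polarization turns it into half the sum of both squares minus half the
  square of their difference, so both quantities are controlled together.\<close>

lemma objective_descent:
  fixes f :: "'a \<Rightarrow> real" and G :: "'a \<Rightarrow> 'a"
  assumes deriv: "\<And>y. GDERIV f y :> G y" and lip: "\<And>y z. norm (G y - G z) \<le> K * norm (y - z)" "K \<ge> 0"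
    and G_bound: "\<And>y. norm (G y) \<le> C'" and f: "C'-lipschitz_on UNIV f"
    and [measurable]: "f \<in> borel_measurable borel" "G \<in> borel_measurable borel"
  defines "avg \<equiv> \<lambda>y :: 'a^'m. agent_mean (($) y)"
  shows "integrable M (\<lambda>\<omega>. f (avg (X k \<omega>)))"
    and "\<epsilon> k * \<alpha> k * (expectation (\<lambda>\<omega>. (norm (G (avg (X k \<omega>))))\<^sup>2) + expectation (\<lambda>\<omega>. (norm (avg (H (X k \<omega>))))\<^sup>2))
      \<le> 2 * expectation (\<lambda>\<omega>. f (avg (X k \<omega>))) - 2 * expectation (\<lambda>\<omega>. f (avg (X (Suc k) \<omega>)))
        + \<epsilon> k * \<alpha> k * expectation (\<lambda>\<omega>. (norm (G (avg (X k \<omega>)) - avg (H (X k \<omega>))))\<^sup>2)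
        + 2 * K * drift_bound * (\<epsilon> k * \<alpha> k)\<^sup>2"
proof -
  have linear_avg: "linear avg" unfolding avg_def by (rule linear_agent_mean)
  note [measurable] = borel_measurable_linear[OF linear_avg]
  have avg2: "integrable M (\<lambda>\<omega>. (norm (avg (X k \<omega>)))\<^sup>2)" for k
    by (intro integrable_norm_square_linear[OF linear_avg] square_integrable) measurable
  show fi: "integrable M (\<lambda>\<omega>. f (avg (X k \<omega>)))" for k
  proof (rule Bochner_Integration.integrable_bound)
    \<comment> \<open>A Lipschitz function grows at most linearly, so a square integrable mean makes
      the objective integrable.\<close>
    show "integrable M (\<lambda>\<omega>. \<bar>f 0\<bar> + C' * norm (avg (X k \<omega>)))"
      using integrable_of_norm_square[OF _ avg2[of k]] by auto
    have "\<bar>f y\<bar> \<le> \<bar>f 0\<bar> + C' * norm y" for y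
      using lipschitz_on_normD[OF f, of y 0] by simp
    moreover have "C' * norm y \<ge> 0" for y :: 'a using lipschitz_on_nonneg[OF f] by simp
    ultimately show "AE \<omega> in M. norm (f (avg (X k \<omega>))) \<le> norm (\<bar>f 0\<bar> + C' * norm (avg (X k \<omega>)))"
      by (intro AE_I2) (auto intro: order.trans)
  qed measurable
  define c where "c = \<epsilon> k * \<alpha> k"
  have "c > 0" using \<epsilon>_pos \<alpha>_pos by (simp add: c_def)
  define g where "g \<omega> = G (avg (X k \<omega>))" for \<omega>
  define h where "h \<omega> = avg (H (X k \<omega>))" for \<omega>
  define n where "n \<omega> = avg (noise k \<omega>)" for \<omega>
  have [measurable]: "random_variable borel g" "random_variable borel h" "random_variable borel n"
    unfolding g_def h_def n_def by measurable
  have g2: "integrable M (\<lambda>\<omega>. (norm (g \<omega>))\<^sup>2)"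
    by (rule integrable_norm_square_bounded[of _ C']) (simp_all add: g_def G_bound)
  have h2: "integrable M (\<lambda>\<omega>. (norm (h \<omega>))\<^sup>2)" "integrable M (\<lambda>\<omega>. (norm (n \<omega>))\<^sup>2)"
    unfolding h_def n_def by (intro integrable_norm_square_linear[OF linear_avg] square_integrable; measurable)+
  have hn2: "integrable M (\<lambda>\<omega>. (norm (h \<omega> + n \<omega>))\<^sup>2)" "integrable M (\<lambda>\<omega>. (norm (g \<omega> - h \<omega>))\<^sup>2)"
    by (intro integrable_norm_square_intros h2 g2; measurable)+
  have gn: "integrable M (\<lambda>\<omega>. g \<omega> \<bullet> n \<omega>)" by (intro integrable_inner h2 g2) measurable
  \<comment> \<open>The gradient at the mean is a function of the current state and hence an
    admissible test function.\<close>
  have orth: "expectation (\<lambda>\<omega>. g \<omega> \<bullet> n \<omega>) = 0"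
    unfolding g_def n_def
    by (rule noise_linear_orthogonal[OF linear_avg, of "\<lambda>y. G (avg y)"]) (use g2 in \<open>auto simp: g_def\<close>)
  have "expectation (\<lambda>\<omega>. f (avg (X (Suc k) \<omega>)))
      \<le> expectation (\<lambda>\<omega>. f (avg (X k \<omega>)) - c / 2 * (norm (g \<omega>))\<^sup>2 - c / 2 * (norm (h \<omega>))\<^sup>2
        + c / 2 * (norm (g \<omega> - h \<omega>))\<^sup>2 - c * (g \<omega> \<bullet> n \<omega>) + K * c\<^sup>2 * (norm (h \<omega> + n \<omega>))\<^sup>2)"
  proof (intro integral_mono Bochner_Integration.integrable_add Bochner_Integration.integrable_diff
      integrable_mult_right fi g2 h2 hn2 gn)
    fix \<omega> assume "\<omega> \<in> space M"
    then have "avg (X (Suc k) \<omega>) = avg (X k \<omega>) + (- c) *\<^sub>R (h \<omega> + n \<omega>)"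
      unfolding avg_def agent_mean_step[OF \<open>\<omega> \<in> space M\<close>]
      by (simp add: h_def n_def c_def avg_def linear_add[OF linear_agent_mean])
    then have "f (avg (X (Suc k) \<omega>)) \<le> f (avg (X k \<omega>)) + ((- c) *\<^sub>R (h \<omega> + n \<omega>)) \<bullet> g \<omega> + K * (norm ((- c) *\<^sub>R (h \<omega> + n \<omega>)))\<^sup>2"
      using descent_bound[OF deriv lip(1), of "avg (X k \<omega>)" "(- c) *\<^sub>R (h \<omega> + n \<omega>)"] by (simp only: g_def)
    also have "K * (norm ((- c) *\<^sub>R (h \<omega> + n \<omega>)))\<^sup>2 = K * c\<^sup>2 * (norm (h \<omega> + n \<omega>))\<^sup>2"
      by (simp add: power_mult_distrib)
    also have "((- c) *\<^sub>R (h \<omega> + n \<omega>)) \<bullet> g \<omega> = - c / 2 * (norm (g \<omega>))\<^sup>2 - c / 2 * (norm (h \<omega>))\<^sup>2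
        + c / 2 * (norm (g \<omega> - h \<omega>))\<^sup>2 - c * (g \<omega> \<bullet> n \<omega>)"
      unfolding power2_norm_eq_inner by (simp add: inner_add inner_diff inner_commute algebra_simps)
    finally show "f (avg (X (Suc k) \<omega>)) \<le> f (avg (X k \<omega>)) - c / 2 * (norm (g \<omega>))\<^sup>2 - c / 2 * (norm (h \<omega>))\<^sup>2
        + c / 2 * (norm (g \<omega> - h \<omega>))\<^sup>2 - c * (g \<omega> \<bullet> n \<omega>) + K * c\<^sup>2 * (norm (h \<omega> + n \<omega>))\<^sup>2"
      by simp
  qed
  also have "\<dots> = expectation (\<lambda>\<omega>. f (avg (X k \<omega>))) - c / 2 * expectation (\<lambda>\<omega>. (norm (g \<omega>))\<^sup>2)
      - c / 2 * expectation (\<lambda>\<omega>. (norm (h \<omega>))\<^sup>2) + c / 2 * expectation (\<lambda>\<omega>. (norm (g \<omega> - h \<omega>))\<^sup>2)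
      + K * c\<^sup>2 * expectation (\<lambda>\<omega>. (norm (h \<omega> + n \<omega>))\<^sup>2)"
    using fi g2 h2 hn2 gn orth by simp
  also have "K * c\<^sup>2 * expectation (\<lambda>\<omega>. (norm (h \<omega> + n \<omega>))\<^sup>2) \<le> K * c\<^sup>2 * drift_bound"
    using drift_moment[of k] lip(2)
    by (intro mult_left_mono) (simp_all add: h_def n_def avg_def linear_add[OF linear_agent_mean])
  finally show "\<epsilon> k * \<alpha> k * (expectation (\<lambda>\<omega>. (norm (G (avg (X k \<omega>))))\<^sup>2) + expectation (\<lambda>\<omega>. (norm (avg (H (X k \<omega>))))\<^sup>2))
      \<le> 2 * expectation (\<lambda>\<omega>. f (avg (X k \<omega>))) - 2 * expectation (\<lambda>\<omega>. f (avg (X (Suc k) \<omega>)))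
        + \<epsilon> k * \<alpha> k * expectation (\<lambda>\<omega>. (norm (G (avg (X k \<omega>)) - avg (H (X k \<omega>))))\<^sup>2)
        + 2 * K * drift_bound * (\<epsilon> k * \<alpha> k)\<^sup>2"
    unfolding g_def[symmetric] h_def[symmetric] c_def[symmetric] by (simp add: algebra_simps)
qed

lemma weighted_gradient_averages_tendsto_0:
  fixes f :: "'a \<Rightarrow> real" and G :: "'a \<Rightarrow> 'a"
  assumes "\<rho> > 0" and gap: "\<And>y :: 'a^'m. \<rho> * (norm (deviation y))\<^sup>2 \<le> deviation y \<bullet> diffusion W y"
    and deriv: "\<And>y. GDERIV f y :> G y" and lip: "\<And>y z. norm (G y - G z) \<le> K * norm (y - z)" "K \<ge> 0"
    and G_bound: "\<And>y. norm (G y) \<le> C'" and f: "C'-lipschitz_on UNIV f"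
    and [measurable]: "f \<in> borel_measurable borel" "G \<in> borel_measurable borel"
    and lower: "\<And>y. m \<le> f y"
    and error: "\<And>y :: 'a^'m. (norm (G (agent_mean (($) y)) - agent_mean (($) (H y))))\<^sup>2 \<le> c4 * (norm (deviation y))\<^sup>2"
    and T: "filterlim (\<lambda>t. \<Sum>k<t. \<epsilon> k * \<alpha> k) at_top sequentially"
    and sum: "summable (\<lambda>k. (\<epsilon> k)\<^sup>2)" "summable (\<lambda>k. \<epsilon> k * (\<alpha> k)\<^sup>2)"
  shows "(\<lambda>t. (\<Sum>k<t. \<epsilon> k * \<alpha> k * expectation (\<lambda>\<omega>. (norm (G (agent_mean (($) (X k \<omega>)))))\<^sup>2))
            / (\<Sum>k<t. \<epsilon> k * \<alpha> k)) \<longlonglongrightarrow> 0"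
    and "(\<lambda>t. (\<Sum>k<t. \<epsilon> k * \<alpha> k * expectation (\<lambda>\<omega>. (norm (agent_mean (($) (H (X k \<omega>)))))\<^sup>2))
            / (\<Sum>k<t. \<epsilon> k * \<alpha> k)) \<longlonglongrightarrow> 0"
proof -
  obtain B where B: "B \<ge> 0" "\<And>y :: 'a^'m. (norm (diffusion W y))\<^sup>2 \<le> B * (norm y)\<^sup>2"
    using linear_norm_square_bound[OF linear_diffusion] by blast
  have "(\<lambda>k. (\<epsilon> k)\<^sup>2) \<longlonglongrightarrow> 0" using sum(1) by (rule summable_LIMSEQ_zero)
  then have "\<epsilon> \<longlonglongrightarrow> 0" by simp
  then have "Bseq \<epsilon>" using convergent_def convergent_imp_Bseq by blast
  then obtain b where "\<And>k. norm (\<epsilon> k) \<le> b" unfolding Bseq_def by blast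
  then have b: "\<epsilon> k \<le> b" for k by (metis abs_le_D1 real_norm_def)
  then have "b \<ge> 0" using \<epsilon>_pos[of 0] by (meson less_imp_le order.trans)
  \<comment> \<open>Since \<open>\<epsilon>\<close> is bounded by \<open>b\<close>, each term with
    \<open>(\<epsilon> k)\<^sup>2 * (\<alpha> k)\<^sup>2\<close> is dominated by the summable
    \<open>\<epsilon> k * (\<alpha> k)\<^sup>2\<close>.\<close>
  have \<epsilon>2: "(\<epsilon> k)\<^sup>2 \<le> b * \<epsilon> k" for k
    using mult_right_mono[OF b[of k] less_imp_le[OF \<epsilon>_pos[of k]]] by (simp add: power2_eq_square)
  have "s \<ge> 0" using noise_moment[of 0] by (rule order.trans[rotated]) simp
  then have "drift_bound \<ge> 0" by (simp add: drift_bound_def)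
  define u where "u k = expectation (\<lambda>\<omega>. (norm (deviation (X k \<omega>)))\<^sup>2)" for k
  define d where "d k = expectation (\<lambda>\<omega>. (norm (G (agent_mean (($) (X k \<omega>))) - agent_mean (($) (H (X k \<omega>)))))\<^sup>2)" for k
  have "linear (\<lambda>y :: 'a^'m. agent_mean (($) y))" by (rule linear_agent_mean)
  note [measurable] = borel_measurable_linear[OF this]
  have diff_le: "norm (G y - agent_mean (($) (H z))) \<le> C' + C" for y z
  proof -
    have "norm (agent_mean (($) (H z))) \<le> norm (H z)"
      using norm_agent_mean_le[of "H z"] by (simp add: power2_le_iff_abs_le)
    then show ?thesis using norm_triangle_ineq4[of "G y" "agent_mean (($) (H z))"] G_bound[of y] H_bound[of z] by linarith
  qed
  have d2: "integrable M (\<lambda>\<omega>. (norm (G (agent_mean (($) (X k \<omega>))) - agent_mean (($) (H (X k \<omega>)))))\<^sup>2)" for k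
    by (rule integrable_norm_square_bounded[OF _ diff_le]) measurable
  have u2: "integrable M (\<lambda>\<omega>. (norm (deviation (X k \<omega>)))\<^sup>2)" for k
    by (intro square_integrable_intros; measurable)
  have d0: "0 \<le> d k" for k unfolding d_def by simp
  have u0: "0 \<le> u k" for k unfolding u_def by simp
  have du: "d k \<le> c4 * u k" for k
  proof -
    have "d k \<le> expectation (\<lambda>\<omega>. c4 * (norm (deviation (X k \<omega>)))\<^sup>2)"
      unfolding d_def by (intro integral_mono d2 integrable_mult_right u2 error)
    then show ?thesis by (simp add: u_def)
  qed
  have dc: "d k \<le> (C' + C)\<^sup>2" for k
  proof -
    have "d k \<le> expectation (\<lambda>\<omega>. (C' + C)\<^sup>2)"
      unfolding d_def by (intro integral_mono d2 integrable_const power_mono diff_le) simp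
    then show ?thesis by (simp add: prob_space)
  qed
  let ?T = "\<lambda>t. \<Sum>k<t. \<epsilon> k * \<alpha> k"
  \<comment> \<open>\<open>c2\<close> collects the gradient and noise terms after this domination;
    \<open>c3\<close> is the quantizer's response to the size of the mean. The part of the quantizer
    error proportional to \<open>u k\<close> joins the growth term.\<close>
  define c2 where "c2 = (1 / \<rho> + 2 * b) * C\<^sup>2 + 2 * b * s"
  define c3 where "c3 = 2 * B * \<beta> * (CARD('m) * drift_bound)"
  have rec: "u (Suc k) \<le> u k - \<rho> * \<epsilon> k * u k + (2 * B + 2 * B * \<beta>) * (\<epsilon> k)\<^sup>2 * u k
      + (c2 * (\<epsilon> k * (\<alpha> k)\<^sup>2) + c3 * ((\<epsilon> k)\<^sup>2 * (?T k)\<^sup>2))" for k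
  proof -
    have 1: "(\<epsilon> k / \<rho> + 2 * (\<epsilon> k)\<^sup>2) * ((\<alpha> k)\<^sup>2 * C\<^sup>2) \<le> (\<epsilon> k / \<rho> + 2 * (b * \<epsilon> k)) * ((\<alpha> k)\<^sup>2 * C\<^sup>2)"
      using \<epsilon>2[of k] by (intro mult_right_mono) auto
    have 2: "(\<epsilon> k)\<^sup>2 * (2 * (\<alpha> k)\<^sup>2 * s) \<le> (b * \<epsilon> k) * (2 * (\<alpha> k)\<^sup>2 * s)"
      using \<epsilon>2[of k] \<open>s \<ge> 0\<close> by (intro mult_right_mono) auto
    show ?thesis
      using consensus_recursion[OF \<open>\<rho> > 0\<close> gap B, of k] 1 2
      unfolding u_def[symmetric] c2_def c3_def by (simp add: algebra_simps)
  qed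
  have "(\<lambda>t. (\<Sum>k<t. \<epsilon> k * \<alpha> k * d k) / ?T t) \<longlonglongrightarrow> 0"
  proof (rule weighted_average_error_tendsto_0[OF \<epsilon>_pos \<alpha>_pos T sum \<open>\<rho> > 0\<close> u0 _ _ rec d0 du dc])
    show "c2 \<ge> 0" using \<open>\<rho> > 0\<close> \<open>b \<ge> 0\<close> \<open>s \<ge> 0\<close> by (simp add: c2_def)
    show "c3 \<ge> 0" using B(1) \<beta>_nonneg \<open>drift_bound \<ge> 0\<close> by (simp add: c3_def)
  qed
  note error_lim = this
  have "summable (\<lambda>k. (\<epsilon> k * \<alpha> k)\<^sup>2)"
  proof (rule summable_comparison_test'[of "\<lambda>k. b * (\<epsilon> k * (\<alpha> k)\<^sup>2)" 0])
    show "summable (\<lambda>k. b * (\<epsilon> k * (\<alpha> k)\<^sup>2))" using sum(2) by (rule summable_mult)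
    show "norm ((\<epsilon> k * \<alpha> k)\<^sup>2) \<le> b * (\<epsilon> k * (\<alpha> k)\<^sup>2)" for k
      using mult_right_mono[OF \<epsilon>2[of k], of "(\<alpha> k)\<^sup>2"] by (simp add: power_mult_distrib mult.assoc)
  qed
  then have r: "summable (\<lambda>k. 2 * K * drift_bound * (\<epsilon> k * \<alpha> k)\<^sup>2)" by (rule summable_mult)
  note descent = objective_descent[OF deriv lip G_bound f, simplified]
  have fX: "m \<le> expectation (\<lambda>\<omega>. f (agent_mean (($) (X k \<omega>))))" for k
  proof -
    have "expectation (\<lambda>\<omega>. m) \<le> expectation (\<lambda>\<omega>. f (agent_mean (($) (X k \<omega>))))"
      by (intro integral_mono descent(1) lower integrable_const) measurable
    then show ?thesis by (simp add: prob_space)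
  qed
  have nn: "0 \<le> \<epsilon> k * \<alpha> k * expectation (\<lambda>\<omega>. (norm (v \<omega>))\<^sup>2)" for k and v :: "'w \<Rightarrow> 'a"
    using \<epsilon>_pos[of k] \<alpha>_pos[of k] by (intro mult_nonneg_nonneg Bochner_Integration.integral_nonneg) auto
  have "\<epsilon> k * \<alpha> k * expectation (\<lambda>\<omega>. (norm (G (agent_mean (($) (X k \<omega>)))))\<^sup>2)
      + \<epsilon> k * \<alpha> k * expectation (\<lambda>\<omega>. (norm (agent_mean (($) (H (X k \<omega>)))))\<^sup>2)
    \<le> 2 * expectation (\<lambda>\<omega>. f (agent_mean (($) (X k \<omega>)))) - 2 * expectation (\<lambda>\<omega>. f (agent_mean (($) (X (Suc k) \<omega>))))
        + \<epsilon> k * \<alpha> k * d k + 2 * K * drift_bound * (\<epsilon> k * \<alpha> k)\<^sup>2" for k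
    using objective_descent(2)[OF deriv lip G_bound f, of k] unfolding d_def distrib_left by simp
  note le = this
  \<comment> \<open>The lower bound is doubled because the descent inequality carries twice the
    objective. Each average is then obtained by dropping the other nonnegative summand.\<close>
  note lim = weighted_average_of_descent_tendsto_0[OF \<epsilon>_pos \<alpha>_pos T r error_lim,
      where m = "2 * m" and \<Phi> = "\<lambda>k. 2 * expectation (\<lambda>\<omega>. f (agent_mean (($) (X k \<omega>))))"]
  show "(\<lambda>t. (\<Sum>k<t. \<epsilon> k * \<alpha> k * expectation (\<lambda>\<omega>. (norm (G (agent_mean (($) (X k \<omega>)))))\<^sup>2)) / ?T t) \<longlonglongrightarrow> 0"
    by (rule lim) (use fX le nn in \<open>auto intro: order.trans[OF _ le]\<close>)
  show "(\<lambda>t. (\<Sum>k<t. \<epsilon> k * \<alpha> k * expectation (\<lambda>\<omega>. (norm (agent_mean (($) (H (X k \<omega>)))))\<^sup>2)) / ?T t) \<longlonglongrightarrow> 0"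
    by (rule lim) (use fX le nn in \<open>auto intro: order.trans[OF _ le]\<close>)
qed

end

subsection \<open>Convergence of the quantized algorithm\<close>

theorem theorem1:
  fixes M :: "'w measure"
    and D :: "'m::finite \<Rightarrow> 's measure"
    and F :: "'m \<Rightarrow> real^'d \<Rightarrow> 's \<Rightarrow> real"
    and g :: "nat \<Rightarrow> 'm \<Rightarrow> real^'d \<Rightarrow> 's \<Rightarrow> real^'d"
    and Z :: "'z measure"
    and Q :: "real^'d \<Rightarrow> 'z \<Rightarrow> real^'d"
    and \<xi> :: "nat \<Rightarrow> 'm \<Rightarrow> 'w \<Rightarrow> 's"
    and \<zeta> :: "nat \<Rightarrow> 'm \<Rightarrow> 'w \<Rightarrow> 'z"
    and x :: "nat \<Rightarrow> 'm \<Rightarrow> 'w \<Rightarrow> real^'d"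
    and W :: "real^'m^'m"
    and eps lam :: "nat \<Rightarrow> real"
    and L \<sigma> \<beta> :: real
  \<comment> \<open>probability spaces, measurability, well-defined local objectives\<close>
  assumes M: "prob_space M"
    and D: "\<And>i. prob_space (D i)"
    and Z: "prob_space Z"
    and F_integrable: "\<And>i y. integrable (D i) (F i y)"
    and g_measurable: "\<And>k i. (\<lambda>(y, s). g k i y s) \<in> borel_measurable (borel \<Otimes>\<^sub>M D i)"
    and Q_measurable: "(\<lambda>(y, z). Q y z) \<in> borel_measurable (borel \<Otimes>\<^sub>M Z)"
  \<comment> \<open>data samples and quantization seeds, drawn afresh at every iteration\<close>
    and \<xi>_measurable: "\<And>k i. \<xi> k i \<in> measurable M (D i)"
    and \<xi>_law: "\<And>k i. distr M (D i) (\<xi> k i) = D i"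
    and \<zeta>_measurable: "\<And>k i. \<zeta> k i \<in> measurable M Z"
    and \<zeta>_law: "\<And>k i. distr M Z (\<zeta> k i) = Z"
    and fresh: "prob_space.indep_vars M (\<lambda>k. \<Pi>\<^sub>M i\<in>UNIV. D i \<Otimes>\<^sub>M Z) (\<lambda>k \<omega> i. (\<xi> k i \<omega>, \<zeta> k i \<omega>)) UNIV"
  \<comment> \<open>the algorithm\<close>
    and eps_pos: "\<And>k. eps k > 0"
    and lam_pos: "\<And>k. lam k > 0"
    and x_init: "\<And>i \<omega>. \<omega> \<in> space M \<Longrightarrow> x 0 i \<omega> = 0"
    and x_step: "\<And>k i \<omega>. \<omega> \<in> space M \<Longrightarrow> x (Suc k) i \<omega> =
          x k i \<omega>
          + eps k *\<^sub>R (\<Sum>j\<in>neighbors W i. W $ i $ j *\<^sub>R (Q (x k j \<omega>) (\<zeta> k j \<omega>) - Q (x k i \<omega>) (\<zeta> k i \<omega>)))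
          - (eps k * lam k) *\<^sub>R g k i (x k i \<omega>) (\<xi> k i \<omega>)"
  \<comment> \<open>gradient assumption\<close>
    and f_lipschitz: "\<And>i. \<exists>C. lipschitz_on C UNIV (local_objective D F i)"
    and f_differentiable: "\<And>i y. local_objective D F i differentiable at y"
    and gradient_lipschitz: "\<And>i y z.
          norm (gradient (local_objective D F i) y - gradient (local_objective D F i) z) \<le> L * norm (y - z)"
    and optimum: "\<exists>xopt. (\<forall>y. global_objective D F xopt \<le> global_objective D F y)
          \<and> (\<Sum>i\<in>UNIV. gradient (local_objective D F i) xopt) = 0"
    and g_unbiased: "\<And>k i. AE \<omega> in M.
          (\<integral>s. g k i (x k i \<omega>) s \<partial>D i) = gradient (local_objective D F i) (x k i \<omega>)"
    and g_square_integrable: "\<And>k i y.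
          integrable (D i) (\<lambda>s. (norm (g k i y s - gradient (local_objective D F i) y))\<^sup>2)"
    and g_variance: "\<And>k i y.
          (\<integral>s. (norm (g k i y s - gradient (local_objective D F i) y))\<^sup>2 \<partial>D i) \<le> \<sigma>\<^sup>2"
  \<comment> \<open>connectivity assumption (a one-vertex graph is connected)\<close>
    and W_nonneg: "\<And>i j. W $ i $ j \<ge> 0"
    and W_symmetric: "\<And>i j. W $ i $ j = W $ j $ i"
    and connected: "CARD('m) \<ge> 2 \<Longrightarrow> second_smallest_eigenvalue (laplacian W) > 0"
  \<comment> \<open>quantizer assumption\<close>
    and Q_square_integrable: "\<And>y. integrable Z (\<lambda>z. (norm (Q y z - y))\<^sup>2)"
    and Q_unbiased: "\<And>y. (\<integral>z. Q y z \<partial>Z) = y"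
    and Q_variance: "\<And>y. (\<integral>z. (norm (Q y z - y))\<^sup>2 \<partial>Z) \<le> \<beta> * (norm y)\<^sup>2"
    and Q_independent: "\<And>k. prob_space.indep_vars M (\<lambda>_. Z) (\<lambda>i. \<zeta> k i) UNIV"
  \<comment> \<open>step sizes\<close>
    and sum_eps_lam: "filterlim (\<lambda>n. \<Sum>k=1..n. eps k * lam k) at_top sequentially"
    and sum_eps2: "summable (\<lambda>k. (eps (Suc k))\<^sup>2)"
    and sum_eps_lam2: "summable (\<lambda>k. eps (Suc k) * (lam (Suc k))\<^sup>2)"
  shows "(\<lambda>t. (\<Sum>k=0..t. eps k * lam k *
              (\<integral>\<omega>. (norm (gradient (global_objective D F) (agent_mean (\<lambda>i. x k i \<omega>))))\<^sup>2 \<partial>M))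
            / (\<Sum>k=0..t. eps k * lam k)) \<longlonglongrightarrow> 0
       \<and> (\<lambda>t. (\<Sum>k=0..t. eps k * lam k *
              (\<integral>\<omega>. (norm (agent_mean (\<lambda>i. gradient (local_objective D F i) (x k i \<omega>))))\<^sup>2 \<partial>M))
            / (\<Sum>k=0..t. eps k * lam k)) \<longlonglongrightarrow> 0"
proof -
  interpret prob_space M by fact
  define grad where "grad i = gradient (local_objective D F i)" for i
  define X where "X k \<omega> = (\<chi> i. x k i \<omega>)" for k \<omega>
  define U where "U k \<omega> i = (\<xi> k i \<omega>, \<zeta> k i \<omega>)" for k \<omega> i
  define N where "N = (\<Pi>\<^sub>M i\<in>UNIV. D i \<Otimes>\<^sub>M Z)"
  \<comment> \<open>One step as a deterministic map of the state and the current inputs, the form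
    that \<open>fresh_noise_of_recursion\<close> expects.\<close>
  define \<Phi> where "\<Phi> k y u = (\<chi> i. y $ i
      + eps k *\<^sub>R (\<Sum>j\<in>neighbors W i. W $ i $ j *\<^sub>R (Q (y $ j) (snd (u j)) - Q (y $ i) (snd (u i))))
      - (eps k * lam k) *\<^sub>R g k i (y $ i) (fst (u i)))" for k and y :: "(real^'d)^'m" and u :: "'m \<Rightarrow> 's \<times> 'z"
  define G where "G y = agent_mean (\<lambda>i. grad i y)" for y
  define H where "H y = (\<chi> i. grad i (y $ i))" for y :: "(real^'d)^'m"
  define err where "err k \<omega> = (\<chi> j. Q (X k \<omega> $ j) (\<zeta> k j \<omega>) - X k \<omega> $ j)" for k \<omega>
  define noise where "noise k \<omega> = (\<chi> i. g k i (X k \<omega> $ i) (\<xi> k i \<omega>) - grad i (X k \<omega> $ i))" for k \<omega>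

  \<comment> \<open>Uniform gradient bounds and the gradient mismatch\<close>
  obtain C0 where C0: "\<And>i. (C0 i)-lipschitz_on UNIV (local_objective D F i)"
    using f_lipschitz by metis
  define C where "C = (\<Sum>i\<in>UNIV. C0 i)"
  have lip: "C-lipschitz_on UNIV (local_objective D F i)" for i
    using C0[of i] unfolding C_def
    by (rule lipschitz_on_mono) (auto intro!: member_le_sum lipschitz_on_nonneg[OF C0])
  \<comment> \<open>\<open>L\<close> is replaced by its absolute value because the descent lemma
    asks for a nonnegative constant.\<close>
  have grad_lip: "norm (grad i y - grad i z) \<le> \<bar>L\<bar> * norm (y - z)" for i y z
    using gradient_lipschitz[of i y z] abs_ge_self[of L] unfolding grad_def
    by (meson mult_right_mono norm_ge_zero order.trans)
  have grad_bound: "norm (grad i y) \<le> C" for i y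
    unfolding grad_def by (rule norm_GDERIV_le[OF lip GDERIV_gradient[OF f_differentiable]])
  have grad_measurable: "grad i \<in> borel_measurable borel" for i
    by (rule borel_measurable_lipschitz[OF grad_lip])
  have G_deriv: "GDERIV (global_objective D F) y :> G y" for y
    unfolding G_def grad_def by (rule GDERIV_global_objective[OF f_differentiable])
  have G_lip: "norm (G y - G z) \<le> \<bar>L\<bar> * norm (y - z)" for y z
    unfolding G_def agent_mean_diff[symmetric] by (rule norm_agent_mean_le_bound[OF grad_lip])
  have G_bound: "norm (G y) \<le> C" for y
    unfolding G_def by (rule norm_agent_mean_le_bound[OF grad_bound])
  have f_lip: "C-lipschitz_on UNIV (global_objective D F)"
    by (rule lipschitz_global_objective[OF lip])
  obtain xopt where xopt: "\<And>y. global_objective D F xopt \<le> global_objective D F y"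
    using optimum by blast
  have H_bound: "norm (H y) \<le> CARD('m) * C" for y
  proof -
    have "norm (H y) \<le> (\<Sum>i\<in>UNIV. norm (H y $ i))" unfolding norm_vec_def by (rule L2_set_le_sum) simp
    also have "\<dots> \<le> (\<Sum>i\<in>(UNIV :: 'm set). C)" by (intro sum_mono) (simp add: H_def grad_bound)
    finally show ?thesis by simp
  qed
  have error: "(norm (G (agent_mean (($) y)) - agent_mean (($) (H y))))\<^sup>2 \<le> \<bar>L\<bar>\<^sup>2 * (norm (deviation y))\<^sup>2" for y
  proof -
    define v where "v = (\<chi> i. grad i (agent_mean (($) y)) - grad i (y $ i))"
    have "G (agent_mean (($) y)) - agent_mean (($) (H y)) = agent_mean (($) v)"
      by (simp add: G_def H_def v_def agent_mean_def sum_subtractf scaleR_diff_right)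
    then have "(norm (G (agent_mean (($) y)) - agent_mean (($) (H y))))\<^sup>2 \<le> (norm v)\<^sup>2"
      using norm_agent_mean_le[of v] by simp
    also have "\<dots> \<le> (\<Sum>i\<in>UNIV. (\<bar>L\<bar> * norm (deviation y $ i))\<^sup>2)"
      unfolding norm_vec_square[of v]
      by (intro sum_mono power_mono) (use grad_lip in \<open>auto simp: v_def deviation_def norm_minus_commute\<close>)
    also have "\<dots> = \<bar>L\<bar>\<^sup>2 * (norm (deviation y))\<^sup>2"
      by (simp only: norm_vec_square[of "deviation y"] power_mult_distrib sum_distrib_left)
    finally show ?thesis .
  qed
  have "\<beta> \<ge> 0"
  proof -
    \<comment> \<open>The sign of \<open>\<beta>\<close> is read off from the variance bound at one
      nonzero vector.\<close>
    have "0 \<le> \<beta> * (norm (1 :: real^'d))\<^sup>2"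
      using Q_variance[of 1] by (rule order.trans[rotated]) simp
    moreover have "(1 :: real^'d) \<noteq> 0" by (simp add: vec_eq_iff)
    ultimately show ?thesis by (simp add: zero_le_mult_iff)
  qed

  \<comment> \<open>The state as a recursion driven by fresh inputs\<close>
  have U_coordinate: "(\<lambda>u. u i) \<in> measurable N (D i \<Otimes>\<^sub>M Z)" for i
    unfolding N_def by (rule measurable_component_singleton) simp
  have coordinate: "(\<lambda>p. snd p i) \<in> measurable (borel \<Otimes>\<^sub>M N) (D i \<Otimes>\<^sub>M Z)" for i
    by (rule measurable_compose[OF measurable_snd U_coordinate])
  have state_coordinate: "(\<lambda>p :: ((real^'d)^'m) \<times> 'c. fst p $ i) \<in> borel_measurable (borel \<Otimes>\<^sub>M A)" for i :: 'm and A :: "'c measure"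
    by (rule borel_measurable_vec_nth) (rule measurable_fst)
  have Q_component: "(\<lambda>(y, u). Q (y $ j) (snd (u j))) \<in> borel_measurable (borel \<Otimes>\<^sub>M N)" for j
  proof -
    have "(\<lambda>p :: ((real^'d)^'m) \<times> ('m \<Rightarrow> 's \<times> 'z). (fst p $ j, snd (snd p j))) \<in> measurable (borel \<Otimes>\<^sub>M N) (borel \<Otimes>\<^sub>M Z)"
      by (intro measurable_Pair state_coordinate measurable_compose[OF coordinate measurable_snd])
    from measurable_compose[OF this Q_measurable] show ?thesis by (simp add: case_prod_beta')
  qed
  have g_component: "(\<lambda>(y, u). g k i (y $ i) (fst (u i))) \<in> borel_measurable (borel \<Otimes>\<^sub>M N)" for k i
  proof -
    have "(\<lambda>p :: ((real^'d)^'m) \<times> ('m \<Rightarrow> 's \<times> 'z). (fst p $ i, fst (snd p i))) \<in> measurable (borel \<Otimes>\<^sub>M N) (borel \<Otimes>\<^sub>M D i)"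
      by (intro measurable_Pair state_coordinate measurable_compose[OF coordinate measurable_fst])
    from measurable_compose[OF this g_measurable] show ?thesis by (simp add: case_prod_beta')
  qed
  have \<Phi>_measurable: "(\<lambda>(y, u). \<Phi> k y u) \<in> borel_measurable (borel \<Otimes>\<^sub>M N)" for k
    using Q_component g_component unfolding \<Phi>_def case_prod_beta'
    by (intro borel_measurable_vec_lambda borel_measurable_add borel_measurable_diff borel_measurable_scaleR
        borel_measurable_sum borel_measurable_const borel_measurable_vec_nth measurable_fst)
  have init: "X 0 \<omega> = 0" if "\<omega> \<in> space M" for \<omega>
    by (simp add: X_def x_init[OF that] vec_eq_iff)
  have step: "X (Suc k) \<omega> = \<Phi> k (X k \<omega>) (U k \<omega>)" if "\<omega> \<in> space M" for k \<omega>
    by (simp add: X_def \<Phi>_def U_def x_step[OF that])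
  have ind: "indep_vars (\<lambda>_. N) U UNIV"
    using fresh unfolding N_def U_def[abs_def] .
  have fst_U: "(\<lambda>u. fst (u i)) \<in> measurable N (D i)" and snd_U: "(\<lambda>u. snd (u i)) \<in> measurable N Z" for i
    by (rule measurable_compose[OF U_coordinate measurable_fst], rule measurable_compose[OF U_coordinate measurable_snd])
  have fresh_\<xi>: "fresh_noise (X k) (D i) (\<xi> k i)" for k i
    using fresh_noise_of_recursion[OF ind init step \<Phi>_measurable fst_U[of i], where k = k] by (simp add: U_def \<xi>_law)
  have fresh_\<zeta>: "fresh_noise (X k) Z (\<zeta> k i)" for k i
    using fresh_noise_of_recursion[OF ind init step \<Phi>_measurable snd_U[of i], where k = k] by (simp add: U_def \<zeta>_law)
  have X_measurable: "random_variable borel (X k)" for k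
    using fresh_\<zeta> by (auto simp: fresh_noise_def)

  \<comment> \<open>Centring and moments of gradient noise and quantization error\<close>
  have noise_q: "(\<lambda>(y, s). g k i (y $ i) s - grad i (y $ i)) \<in> borel_measurable (borel \<Otimes>\<^sub>M D i)" for k i
    using measurable_compose[OF measurable_Pair[OF state_coordinate measurable_snd] g_measurable[where k = k and i = i], of i]
      measurable_compose[OF state_coordinate[of i "D i"] grad_measurable[of i]]
    by (simp add: case_prod_beta')
  have noise_int: "integrable (D i) (\<lambda>s. (norm (g k i (y $ i) s - grad i (y $ i)))\<^sup>2)" for k i and y :: "(real^'d)^'m"
    unfolding grad_def by (rule g_square_integrable)
  have noise_le: "(\<integral>s. (norm (g k i (y $ i) s - grad i (y $ i)))\<^sup>2 \<partial>D i) \<le> \<sigma>\<^sup>2" for k i and y :: "(real^'d)^'m"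
    unfolding grad_def by (rule g_variance)
  have noise_mean: "AE \<omega> in M. (\<integral>s. g k i (X k \<omega> $ i) s - grad i (X k \<omega> $ i) \<partial>D i) = 0" for k i
    using g_unbiased[where k = k and i = i]
  proof eventually_elim
    case (elim \<omega>)
    interpret D: prob_space "D i" by (rule D)
    have "(\<lambda>s. g k i (X k \<omega> $ i) s - grad i (X k \<omega> $ i)) \<in> borel_measurable (D i)"
      using measurable_compose[OF measurable_Pair1' noise_q[of k i], of "X k \<omega>"] by simp
    \<comment> \<open>The mean of a difference splits only for integrable terms. Integrability of
      the stochastic gradient is recovered from its centred version plus a constant; the quantizer
      is treated alike below.\<close>
    from D.integrable_of_norm_square[OF this noise_int]
    have "integrable (D i) (\<lambda>s. (g k i (X k \<omega> $ i) s - grad i (X k \<omega> $ i)) + grad i (X k \<omega> $ i))"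
      by (intro Bochner_Integration.integrable_add D.integrable_const)
    then show ?case using elim by (simp add: X_def grad_def D.prob_space)
  qed
  have err_q: "(\<lambda>(y, z). Q (y $ j) z - y $ j) \<in> borel_measurable (borel \<Otimes>\<^sub>M Z)" for j :: 'm
    using measurable_compose[OF measurable_Pair[OF state_coordinate measurable_snd] Q_measurable, of j]
      state_coordinate[of j Z]
    by (simp add: case_prod_beta')
  have err_mean: "(\<integral>z. Q y z - y \<partial>Z) = 0" for y
  proof -
    interpret Z: prob_space Z by (rule Z)
    have "(\<lambda>z. Q y z - y) \<in> borel_measurable Z"
      using measurable_compose[OF measurable_Pair1' Q_measurable, of y] by simp
    from Z.integrable_of_norm_square[OF this Q_square_integrable]
    have "integrable Z (\<lambda>z. (Q y z - y) + y)"
      by (intro Bochner_Integration.integrable_add Z.integrable_const)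
    then show ?thesis by (simp add: Q_unbiased Z.prob_space)
  qed
  have V_measurable: "(\<lambda>y :: (real^'d)^'m. \<beta> * (norm (y $ j))\<^sup>2) \<in> borel_measurable borel" for j
    by (intro borel_measurable_times borel_measurable_const borel_measurable_power
        measurable_compose[OF borel_measurable_nth borel_measurable_norm])
  have X2: "integrable M (\<lambda>\<omega>. (norm (X k \<omega> $ j))\<^sup>2)" if "integrable M (\<lambda>\<omega>. (norm (X k \<omega>))\<^sup>2)" for k j
    using that
    by (rule Bochner_Integration.integrable_bound)
      (auto intro!: AE_I2 power_mono Finite_Cartesian_Product.norm_nth_le borel_measurable_power
          measurable_compose[OF borel_measurable_vec_nth[OF X_measurable] borel_measurable_norm])
  have V_int: "integrable M (\<lambda>\<omega>. \<beta> * (norm (X k \<omega> $ j))\<^sup>2)" if "integrable M (\<lambda>\<omega>. (norm (X k \<omega>))\<^sup>2)" for k j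
    using X2[OF that] by simp

  interpret noisy_consensus M W X err noise H eps lam \<beta> "CARD('m) * \<sigma>\<^sup>2" "CARD('m) * C"
  proof
    show "random_variable borel (X k)" for k by (rule X_measurable)
    show "random_variable borel (err k)" for k
      unfolding err_def
      by (intro borel_measurable_vec_lambda)
       (use measurable_compose[OF measurable_Pair[OF X_measurable \<zeta>_measurable] err_q] in simp)
    show "random_variable borel (noise k)" for k
      unfolding noise_def
      by (rule stacked_noise_measurable[OF fresh_\<xi> noise_q noise_int noise_le]) auto
    show "H \<in> borel_measurable borel"
      unfolding H_def
      by (intro borel_measurable_vec_lambda measurable_compose[OF borel_measurable_nth grad_measurable])
    show "W $ i $ j = W $ j $ i" for i j by (rule W_symmetric)
    show "eps k > 0" "lam k > 0" for k by (rule eps_pos, rule lam_pos)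
    show "X 0 \<omega> = 0" if "\<omega> \<in> space M" for \<omega> using that by (rule init)
    show "norm (H y) \<le> CARD('m) * C" for y by (rule H_bound)
    show "\<beta> \<ge> 0" by fact
    show "X (Suc k) \<omega> = X k \<omega> - eps k *\<^sub>R diffusion W (X k \<omega> + err k \<omega>)
        - (eps k * lam k) *\<^sub>R (H (X k \<omega>) + noise k \<omega>)" if "\<omega> \<in> space M" for k \<omega>
    proof -
      have "(\<Sum>j\<in>neighbors W i. W $ i $ j *\<^sub>R (Q (x k j \<omega>) (\<zeta> k j \<omega>) - Q (x k i \<omega>) (\<zeta> k i \<omega>)))
          = - (diffusion W (X k \<omega> + err k \<omega>) $ i)" for i
      proof -
        \<comment> \<open>Zero weights extend the sum to all agents; the sign change then gives the
          diffusion of the quantized state, which is \<open>X k + err k\<close>.\<close>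
        have "W $ i $ j = 0" if "j \<notin> neighbors W i" for j
          using that W_nonneg[of i j] by (simp add: neighbors_def)
        then have "(\<Sum>j\<in>neighbors W i. W $ i $ j *\<^sub>R (Q (x k j \<omega>) (\<zeta> k j \<omega>) - Q (x k i \<omega>) (\<zeta> k i \<omega>)))
            = (\<Sum>j\<in>UNIV. W $ i $ j *\<^sub>R (Q (x k j \<omega>) (\<zeta> k j \<omega>) - Q (x k i \<omega>) (\<zeta> k i \<omega>)))"
          by (intro sum.mono_neutral_left) auto
        also have "\<dots> = (\<Sum>j\<in>UNIV. - (W $ i $ j *\<^sub>R (Q (x k i \<omega>) (\<zeta> k i \<omega>) - Q (x k j \<omega>) (\<zeta> k j \<omega>))))"
          by (intro sum.cong refl) (simp add: scaleR_diff_right)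
        finally show ?thesis by (simp add: diffusion_def X_def err_def sum_negf)
      qed
      then show ?thesis
        by (simp add: vec_eq_iff X_def[of "Suc k"] x_step[OF that]) (simp add: X_def noise_def H_def)
    qed
    fix k
    show "integrable M (\<lambda>\<omega>. (norm (noise k \<omega>))\<^sup>2)"
      unfolding noise_def by (rule stacked_noise_square_integrable[OF fresh_\<xi> noise_q noise_int noise_le]) auto
    show "expectation (\<lambda>\<omega>. (norm (noise k \<omega>))\<^sup>2) \<le> CARD('m) * \<sigma>\<^sup>2"
      unfolding noise_def
      using stacked_noise_second_moment[OF fresh_\<xi>[of k] noise_q[of k] noise_int[of _ k] noise_le[of _ k]] by (simp add: prob_space)
    show "expectation (\<lambda>\<omega>. \<phi> (X k \<omega>) \<bullet> noise k \<omega>) = 0"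
      if "\<phi> \<in> borel_measurable borel" "integrable M (\<lambda>\<omega>. (norm (\<phi> (X k \<omega>)))\<^sup>2)" for \<phi>
      unfolding noise_def
      by (rule stacked_noise_orthogonal[OF fresh_\<xi> noise_q noise_int noise_le _ _ noise_mean that]) auto
    assume I: "integrable M (\<lambda>\<omega>. (norm (X k \<omega>))\<^sup>2)"
    note Q_facts = fresh_\<zeta> err_q Q_square_integrable Q_variance V_measurable V_int[OF I]
    show "integrable M (\<lambda>\<omega>. (norm (err k \<omega>))\<^sup>2)"
      unfolding err_def by (rule stacked_noise_square_integrable[OF Q_facts])
    have "expectation (\<lambda>\<omega>. (norm (err k \<omega>))\<^sup>2) \<le> (\<Sum>j\<in>UNIV. expectation (\<lambda>\<omega>. \<beta> * (norm (X k \<omega> $ j))\<^sup>2))"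
      unfolding err_def by (rule stacked_noise_second_moment[OF Q_facts])
    also have "\<dots> = \<beta> * expectation (\<lambda>\<omega>. (norm (X k \<omega>))\<^sup>2)"
      unfolding norm_vec_square[of "X k _"] using X2[OF I] by (simp add: sum_distrib_left)
    finally show "expectation (\<lambda>\<omega>. (norm (err k \<omega>))\<^sup>2) \<le> \<beta> * expectation (\<lambda>\<omega>. (norm (X k \<omega>))\<^sup>2)" .
    show "expectation (\<lambda>\<omega>. \<phi> (X k \<omega>) \<bullet> err k \<omega>) = 0"
      if "\<phi> \<in> borel_measurable borel" "integrable M (\<lambda>\<omega>. (norm (\<phi> (X k \<omega>)))\<^sup>2)" for \<phi>
      unfolding err_def
      by (rule stacked_noise_orthogonal[OF Q_facts _ that]) (simp add: err_mean)
  qed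

  \<comment> \<open>Index conventions of the step-size series and the limits\<close>
  obtain \<rho> where \<rho>: "\<rho> > 0"
    "\<And>y :: (real^'d)^'m. \<rho> * (norm (deviation y))\<^sup>2 \<le> deviation y \<bullet> diffusion W y"
    using diffusion_spectral_gap[OF W_nonneg W_symmetric connected] by blast
  \<comment> \<open>The hypotheses sum from index 1, the limits from index 0; the difference is one
    positive term, so divergence carries over.\<close>
  have T_Suc: "(\<Sum>k<Suc n. eps k * lam k) = (\<Sum>k=1..n. eps k * lam k) + eps 0 * lam 0" for n
    by (simp add: sum.lessThan_Suc_shift sum.atLeast1_atMost_eq del: sum.lessThan_Suc)
  have "filterlim (\<lambda>n. \<Sum>k<Suc n. eps k * lam k) at_top sequentially"
    unfolding T_Suc by (rule filterlim_at_top_mono[OF sum_eps_lam]) (simp add: eps_pos lam_pos less_imp_le)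
  then have T: "filterlim (\<lambda>n. \<Sum>k<n. eps k * lam k) at_top sequentially"
    by (rule iffD1[OF filterlim_sequentially_Suc[of "\<lambda>n. \<Sum>k<n. eps k * lam k"]])
  have f_measurable: "global_objective D F \<in> borel_measurable borel"
    by (intro borel_measurable_continuous_onI lipschitz_on_continuous_on[OF f_lip])
  have G_measurable: "G \<in> borel_measurable borel"
    by (rule borel_measurable_lipschitz[OF G_lip])
  have sums: "summable (\<lambda>k. (eps k)\<^sup>2)" "summable (\<lambda>k. eps k * (lam k)\<^sup>2)"
    using sum_eps2 sum_eps_lam2 summable_Suc_iff[of "\<lambda>k. (eps k)\<^sup>2"] summable_Suc_iff[of "\<lambda>k. eps k * (lam k)\<^sup>2"] by auto
  have G_eq: "gradient (global_objective D F) y = G y" for y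
    by (rule gradient_eq[OF G_deriv])
  note limits = weighted_gradient_averages_tendsto_0[OF \<rho> G_deriv G_lip abs_ge_zero G_bound f_lip
      f_measurable G_measurable xopt error T sums]
  \<comment> \<open>The limits were proved for sums over \<open>k < t\<close>; the shift by one
    turns them into the closed ranges of the claim.\<close>
  have atMost: "{0..t} = {..<Suc t}" for t :: nat by auto
  show ?thesis
    using limits[THEN LIMSEQ_Suc] unfolding atMost G_eq
    by (simp add: X_def H_def G_def grad_def agent_mean_def)
qed

end
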